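(* Let $X$ be an atomic Archimedean vector lattice, let $\mathcal A$ be a maximal family of pairwise disjoint atoms in $X$, let $I_{\mathcal A}=\operatorname{span}\mathcal A$ (the ideal generated by $\mathcal A$), and let $\mathscr A_0=\operatorname{span}\{a\otimes\varphi_b:\ a,b\in\mathcal A\}$. Let $\mathscr A\subseteq \mathscr L_n(X)$ be a subalgebra containing $\mathscr A_0$ and let $\Phi\colon \mathscr A\to\mathscr A$ be a positive algebra automorphism. Then there exist a bijection $\pi\colon\mathcal A\to\mathcal A$ and positive scalars $\{\delta_a:\ a\in\mathcal A\}$ such that, if $P,D\colon I_{\mathcal A}\to I_{\mathcal A}$ denote the invertible linear operators determined by $Pa=\pi(a)$ and $Da=\delta_a a$ for all $a\in\mathcal A$, the following hold. For each $T\in\mathscr A_0$ the ideal $I_{\mathcal A}$ is invariant under $\Phi(T)$ and $$\Phi(T)|_{I_{\mathcal A}}=PDTD^{-1}P^{-1}|_{I_{\mathcal A}}.$$ Furthermore, for each positive $T\in\mathscr A$, $$\Phi(T)|_{I_{\mathcal A}}=\sup\{PDSD^{-1}P^{-1}|_{I_{\mathcal A}}:\ S\in[0,T]\cap\mathscr A_0\},$$ where the supremum is taken in the ordered vector space of linear operators from $I_{\mathcal A}$ to $X$.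
   Context: Vector lattices are real. A net $(x_\alpha)$ in a vector lattice $X$ converges in order to $x$ if there is a net $(y_\beta)$ with $y_\beta\searrow 0$ such that for every $\beta$ there is $\alpha_0$ with $|x_\alpha-x|\le y_\beta$ for all $\alpha\ge\alpha_0$. A linear operator is order continuous if it maps nets converging in order to $0$ to nets converging in order to $0$; $\mathscr L_n(X)$ is the algebra of all order continuous linear operators on $X$. An atom is a nonzero positive vector $a$ such that $0\le x,y\le a$ and $x\perp y$ imply $x=0$ or $y=0$. For an atom $a$ of an Archimedean vector lattice $X$ one has $X=\mathbb R a\oplus\{a\}^d$; the coordinate functional $\varphi_a\colon X\to\mathbb R$ is defined by $x-\varphi_a(x)a\perp a$. It is an order continuous lattice homomorphism. $X$ is atomic if the band generated by all atoms of $X$ equals $X$. For $u\in X$ and a linear functional $\varphi$, $u\otimes\varphi$ is the operator $x\mapsto\varphi(x)u$. An operator $T$ is positive ($T\ge0$) if $Tx\ge0$ for all $x\ge 0$; $S\le T$ means $T-S\ge 0$, and $[0,T]=\{S:\ 0\le S\le T\}$. A positive algebra automorphism of $\mathscr A$ is a bijective linear multiplicative map $\Phi\colon\mathscr A\to\mathscr A$ with $\Phi(T)\ge0$ whenever $T\ge0$. Every $S\in\mathscr A_0$ maps $X$ into $I_{\mathcal A}$, so $PDSD^{-1}P^{-1}$ is well defined on $I_{\mathcal A}$. *)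

theory Defs
  imports Complex_Main "HOL-Library.Function_Algebras" "HOL-Library.Lattice_Algebras"
begin

section \<open>Vector lattices, bands, atoms\<close>

class vector_lattice = ordered_real_vector + lattice_ab_group_add_abs

class archimedean_vector_lattice = vector_lattice +
  assumes archimedean: "(\<And>n::nat. real n *\<^sub>R x \<le> y) \<Longrightarrow> x \<le> 0"

definition disjoint_vec :: "'a::vector_lattice \<Rightarrow> 'a \<Rightarrow> bool"
  where "disjoint_vec x y \<longleftrightarrow> inf \<bar>x\<bar> \<bar>y\<bar> = 0"

definition lattice_ideal :: "'a::vector_lattice set \<Rightarrow> bool"
  where "lattice_ideal I \<longleftrightarrow> subspace I \<and> (\<forall>x y. y \<in> I \<longrightarrow> \<bar>x\<bar> \<le> \<bar>y\<bar> \<longrightarrow> x \<in> I)"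

definition band :: "'a::vector_lattice set \<Rightarrow> bool"
  where "band B \<longleftrightarrow> lattice_ideal B \<and>
    (\<forall>E s. E \<subseteq> B \<longrightarrow> E \<noteq> {} \<longrightarrow> (\<forall>x\<in>E. x \<le> s) \<longrightarrow> (\<forall>u. (\<forall>x\<in>E. x \<le> u) \<longrightarrow> s \<le> u) \<longrightarrow> s \<in> B)"

definition atom :: "'a::vector_lattice \<Rightarrow> bool"
  where "atom a \<longleftrightarrow> 0 \<le> a \<and> a \<noteq> 0 \<and>
    (\<forall>x y. 0 \<le> x \<longrightarrow> x \<le> a \<longrightarrow> 0 \<le> y \<longrightarrow> y \<le> a \<longrightarrow> disjoint_vec x y \<longrightarrow> x = 0 \<or> y = 0)"

definition atomic_lattice :: "'a::vector_lattice itself \<Rightarrow> bool"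
  where "atomic_lattice _ \<longleftrightarrow> band hull {a::'a. atom a} = UNIV"

definition disjoint_atoms :: "'a::vector_lattice set \<Rightarrow> bool"
  where "disjoint_atoms A \<longleftrightarrow> (\<forall>a\<in>A. atom a) \<and> pairwise disjoint_vec A"

definition maximal_disjoint_atoms :: "'a::vector_lattice set \<Rightarrow> bool"
  where "maximal_disjoint_atoms A \<longleftrightarrow>
    disjoint_atoms A \<and> (\<forall>B. disjoint_atoms B \<longrightarrow> A \<subseteq> B \<longrightarrow> B = A)"

text \<open>For an atom of an Archimedean vector lattice the scalar below exists and is unique.\<close>

definition coord :: "'a::vector_lattice \<Rightarrow> 'a \<Rightarrow> real"
  where "coord a x = (THE r. disjoint_vec (x - r *\<^sub>R a) a)"


section \<open>Nets and order convergence\<close>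

text \<open>A net is a function restricted to an index set that is directed by a preorder.\<close>

definition directed_index :: "'i set \<Rightarrow> ('i \<Rightarrow> 'i \<Rightarrow> bool) \<Rightarrow> bool"
  where "directed_index J le \<longleftrightarrow> J \<noteq> {} \<and>
    (\<forall>i\<in>J. le i i) \<and>
    (\<forall>i\<in>J. \<forall>j\<in>J. \<forall>k\<in>J. le i j \<longrightarrow> le j k \<longrightarrow> le i k) \<and>
    (\<forall>i\<in>J. \<forall>j\<in>J. \<exists>k\<in>J. le i k \<and> le j k)"

definition decreases_to_0 :: "'j set \<Rightarrow> ('j \<Rightarrow> 'j \<Rightarrow> bool) \<Rightarrow> ('j \<Rightarrow> 'a::vector_lattice) \<Rightarrow> bool"
  where "decreases_to_0 K le y \<longleftrightarrow> directed_index K le \<and>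
    (\<forall>i\<in>K. \<forall>j\<in>K. le i j \<longrightarrow> y j \<le> y i) \<and>
    (\<forall>i\<in>K. 0 \<le> y i) \<and> (\<forall>z. (\<forall>i\<in>K. z \<le> y i) \<longrightarrow> z \<le> 0)"

definition dominated_by ::
  "'i set \<Rightarrow> ('i \<Rightarrow> 'i \<Rightarrow> bool) \<Rightarrow> ('i \<Rightarrow> 'a::vector_lattice) \<Rightarrow> 'a \<Rightarrow> 'j set \<Rightarrow> ('j \<Rightarrow> 'a) \<Rightarrow> bool"
  where "dominated_by J le x l K y \<longleftrightarrow>
    (\<forall>k\<in>K. \<exists>i0\<in>J. \<forall>i\<in>J. le i0 i \<longrightarrow> \<bar>x i - l\<bar> \<le> y k)"

text \<open>HOL cannot quantify over index types inside a formula. It loses nothing to index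
  the dominating net by a set of elements of the lattice: a net decreasing to \<open>0\<close> may be
  replaced by its range (lemma \<open>converges_in_orderI\<close>).\<close>

definition converges_in_order ::
  "'i set \<Rightarrow> ('i \<Rightarrow> 'i \<Rightarrow> bool) \<Rightarrow> ('i \<Rightarrow> 'a::vector_lattice) \<Rightarrow> 'a \<Rightarrow> bool"
  where "converges_in_order J le x l \<longleftrightarrow>
    (\<exists>(K::'a set) leK y. decreases_to_0 K leK y \<and> dominated_by J le x l K y)"

lemma converges_in_orderI:
  fixes y :: "'j \<Rightarrow> 'a::vector_lattice"
  assumes "decreases_to_0 K leK y" and "dominated_by J le x l K y"
  shows "converges_in_order J le x l"
proof -
  have y: "directed_index K leK" "\<And>i j. i \<in> K \<Longrightarrow> j \<in> K \<Longrightarrow> leK i j \<Longrightarrow> y j \<le> y i"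
    "\<And>i. i \<in> K \<Longrightarrow> 0 \<le> y i" "\<And>z. (\<And>i. i \<in> K \<Longrightarrow> z \<le> y i) \<Longrightarrow> z \<le> 0"
    using assms(1) unfolding decreases_to_0_def by blast+
  have "\<exists>w\<in>y ` K. w \<le> u \<and> w \<le> v" if uv: "u \<in> y ` K" "v \<in> y ` K" for u v
  proof -
    obtain i j where ij: "i \<in> K" "u = y i" "j \<in> K" "v = y j" using uv by blast
    then obtain k where k: "k \<in> K" "leK i k" "leK j k"
      using y(1) unfolding directed_index_def by blast
    show ?thesis
      using y(2)[OF ij(1) k(1,2)] y(2)[OF ij(3) k(1,3)] ij k(1) by blast
  qed
  moreover have "y ` K \<noteq> {}" using y(1) unfolding directed_index_def by blast
  ultimately have "directed_index (y ` K) (\<lambda>u v. v \<le> u)"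
    unfolding directed_index_def by (blast intro: order_trans)
  then have "decreases_to_0 (y ` K) (\<lambda>u v. v \<le> u) (\<lambda>u. u)"
    using y(3,4) unfolding decreases_to_0_def by auto
  moreover have "dominated_by J le x l (y ` K) (\<lambda>u. u)"
    using assms(2) unfolding dominated_by_def by auto
  ultimately show ?thesis unfolding converges_in_order_def by blast
qed


section \<open>Operators\<close>

text \<open>Pointwise real vector space structure on functions; addition is the pointwise one of
  \<open>Function_Algebras\<close>. The pointwise order and product on functions are never used for operators.\<close>

instantiation "fun" :: (type, real_vector) real_vector
begin

definition scaleR_fun :: "real \<Rightarrow> ('a \<Rightarrow> 'b) \<Rightarrow> 'a \<Rightarrow> 'b"
  where "scaleR_fun r f = (\<lambda>x. r *\<^sub>R f x)"

instance
  by standard (auto simp: scaleR_fun_def fun_eq_iff scaleR_add_left scaleR_add_right)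

end

definition linear_on :: "'a::real_vector set \<Rightarrow> ('a \<Rightarrow> 'b::real_vector) \<Rightarrow> bool"
  where "linear_on V T \<longleftrightarrow>
    (\<forall>x\<in>V. \<forall>y\<in>V. T (x + y) = T x + T y) \<and> (\<forall>r. \<forall>x\<in>V. T (r *\<^sub>R x) = r *\<^sub>R T x)"

text \<open>The operator order for operators defined on a subspace \<open>V\<close>: comparison on the positive
  cone of \<open>V\<close>.\<close>

definition op_le :: "'a::vector_lattice set \<Rightarrow> ('a \<Rightarrow> 'a) \<Rightarrow> ('a \<Rightarrow> 'a) \<Rightarrow> bool"
  where "op_le V S T \<longleftrightarrow> (\<forall>x\<in>V. 0 \<le> x \<longrightarrow> S x \<le> T x)"

abbreviation positive_op :: "('a::vector_lattice \<Rightarrow> 'a) \<Rightarrow> bool"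
  where "positive_op T \<equiv> op_le UNIV (\<lambda>_. 0) T"

definition op_interval0 :: "('a::vector_lattice \<Rightarrow> 'a) \<Rightarrow> ('a \<Rightarrow> 'a) set"
  where "op_interval0 T = {S. linear S \<and> positive_op S \<and> op_le UNIV S T}"

text \<open>\<open>U\<close> restricted to \<open>V\<close> is the supremum of the restrictions to \<open>V\<close> of the members of
  \<open>\<S>\<close>, in the ordered vector space of all linear operators from \<open>V\<close> to the whole lattice.
  Operators on \<open>V\<close> are represented by functions whose values outside \<open>V\<close> are ignored.\<close>

definition is_op_sup_on :: "'a::vector_lattice set \<Rightarrow> ('a \<Rightarrow> 'a) set \<Rightarrow> ('a \<Rightarrow> 'a) \<Rightarrow> bool"
  where "is_op_sup_on V \<S> U \<longleftrightarrow> linear_on V U \<and> (\<forall>S\<in>\<S>. op_le V S U) \<and>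
    (\<forall>R. linear_on V R \<longrightarrow> (\<forall>S\<in>\<S>. op_le V S R) \<longrightarrow> op_le V U R)"

text \<open>The index type \<open>'a \<times> 'a set\<close> is large enough to replace any net in the lattice by one
  with the same tails; lemma \<open>order_continuous_opD\<close> gives the property for all index types.\<close>

definition order_continuous_op :: "('a::vector_lattice \<Rightarrow> 'a) \<Rightarrow> bool"
  where "order_continuous_op T \<longleftrightarrow> linear T \<and>
    (\<forall>(J::('a \<times> 'a set) set) le x. directed_index J le \<longrightarrow>
      converges_in_order J le x 0 \<longrightarrow> converges_in_order J le (\<lambda>i. T (x i)) 0)"

lemma order_continuous_opD:
  fixes x :: "'i \<Rightarrow> 'a::vector_lattice"
  assumes T: "order_continuous_op T" and J: "directed_index J le"
    and conv: "converges_in_order J le x 0"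
  shows "converges_in_order J le (\<lambda>i. T (x i)) 0"
proof -
  define tail where "tail i = x ` {j \<in> J. le i j}" for i
  define J' where "J' = {(x j, tail i) | i j. i \<in> J \<and> j \<in> J \<and> le i j}"
  define le' where "le' p q \<longleftrightarrow> snd q \<subseteq> snd p" for p q :: "'a \<times> 'a set"
  have refl: "le i i" if "i \<in> J" for i using J that unfolding directed_index_def by blast
  have tail_mono: "tail j \<subseteq> tail i" if "i \<in> J" "j \<in> J" "le i j" for i j
  proof
    fix u assume "u \<in> tail j"
    then obtain k where k: "k \<in> J" "le j k" "u = x k" unfolding tail_def by blast
    then have "le i k" using J that unfolding directed_index_def by blast
    then show "u \<in> tail i" using k unfolding tail_def by blast
  qed
  have "\<exists>r\<in>J'. le' p r \<and> le' q r" if pq: "p \<in> J'" "q \<in> J'" for p q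
  proof -
    obtain i where ip: "i \<in> J" "snd p = tail i" using pq(1) unfolding J'_def by auto
    obtain i' where iq: "i' \<in> J" "snd q = tail i'" using pq(2) unfolding J'_def by auto
    note i = ip iq
    obtain k where k: "k \<in> J" "le i k" "le i' k"
      using i J unfolding directed_index_def by blast
    have "(x k, tail k) \<in> J'" unfolding J'_def using k refl by blast
    moreover have "le' p (x k, tail k)" "le' q (x k, tail k)"
      using i k tail_mono unfolding le'_def by auto
    ultimately show ?thesis by blast
  qed
  moreover have "J' \<noteq> {}" using J refl unfolding directed_index_def J'_def by blast
  ultimately have dir: "directed_index J' le'"
    unfolding directed_index_def le'_def by blast
  obtain K :: "'a set" and leK y where y: "decreases_to_0 K leK y" "dominated_by J le x 0 K y"
    using conv unfolding converges_in_order_def by blast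
  have "dominated_by J' le' fst 0 K y"
    unfolding dominated_by_def
  proof
    fix k assume "k \<in> K"
    then obtain i0 where i0: "i0 \<in> J" "\<And>i. i \<in> J \<Longrightarrow> le i0 i \<Longrightarrow> \<bar>x i - 0\<bar> \<le> y k"
      using y(2) unfolding dominated_by_def by blast
    have "(x i0, tail i0) \<in> J'" unfolding J'_def using i0 refl by blast
    moreover have "\<bar>fst p - 0\<bar> \<le> y k" if "p \<in> J'" "le' (x i0, tail i0) p" for p
    proof -
      have "fst p \<in> snd p" using that(1) unfolding J'_def tail_def by auto
      then have "fst p \<in> tail i0" using that(2) unfolding le'_def by auto
      then show ?thesis using i0(2) unfolding tail_def by auto
    qed
    ultimately show "\<exists>i0\<in>J'. \<forall>i\<in>J'. le' i0 i \<longrightarrow> \<bar>fst i - 0\<bar> \<le> y k" by blast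
  qed
  then have "converges_in_order J' le' fst 0" using y(1) unfolding converges_in_order_def by blast
  then have "converges_in_order J' le' (\<lambda>p. T (fst p)) 0"
    using T dir unfolding order_continuous_op_def by blast
  then obtain K' :: "'a set" and leK' y' where
    y': "decreases_to_0 K' leK' y'" "dominated_by J' le' (\<lambda>p. T (fst p)) 0 K' y'"
    unfolding converges_in_order_def by blast
  have "dominated_by J le (\<lambda>i. T (x i)) 0 K' y'"
    unfolding dominated_by_def
  proof
    fix k assume "k \<in> K'"
    then obtain p where p: "p \<in> J'" "\<And>q. q \<in> J' \<Longrightarrow> le' p q \<Longrightarrow> \<bar>T (fst q) - 0\<bar> \<le> y' k"
      using y'(2) unfolding dominated_by_def by blast
    obtain i where i: "i \<in> J" "snd p = tail i" using p(1) unfolding J'_def by auto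
    have "\<bar>T (x j) - 0\<bar> \<le> y' k" if "j \<in> J" "le i j" for j
    proof -
      have "(x j, tail i) \<in> J'" using i that unfolding J'_def by blast
      then show ?thesis using p(2)[of "(x j, tail i)"] i unfolding le'_def by auto
    qed
    then show "\<exists>i0\<in>J. \<forall>i\<in>J. le i0 i \<longrightarrow> \<bar>T (x i) - 0\<bar> \<le> y' k" using i(1) by blast
  qed
  then show ?thesis using y'(1) by (rule converges_in_orderI[rotated])
qed

definition rank_one :: "'a::real_vector \<Rightarrow> ('a \<Rightarrow> real) \<Rightarrow> 'a \<Rightarrow> 'a"
  where "rank_one u \<phi> = (\<lambda>x. \<phi> x *\<^sub>R u)"

definition finite_rank_alg :: "'a::vector_lattice set \<Rightarrow> ('a \<Rightarrow> 'a) set"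
  where "finite_rank_alg A = span {rank_one a (coord b) | a b. a \<in> A \<and> b \<in> A}"

text \<open>Subalgebras need not be unital.\<close>

definition subalgebra_of_Ln :: "('a::vector_lattice \<Rightarrow> 'a) set \<Rightarrow> bool"
  where "subalgebra_of_Ln \<AA> \<longleftrightarrow> (\<forall>T\<in>\<AA>. order_continuous_op T) \<and> subspace \<AA> \<and>
    (\<forall>S\<in>\<AA>. \<forall>T\<in>\<AA>. S \<circ> T \<in> \<AA>)"

definition positive_algebra_automorphism ::
  "('a::vector_lattice \<Rightarrow> 'a) set \<Rightarrow> (('a \<Rightarrow> 'a) \<Rightarrow> ('a \<Rightarrow> 'a)) \<Rightarrow> bool"
  where "positive_algebra_automorphism \<AA> \<Phi> \<longleftrightarrow> bij_betw \<Phi> \<AA> \<AA> \<and> linear_on \<AA> \<Phi> \<and>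
    (\<forall>S\<in>\<AA>. \<forall>T\<in>\<AA>. \<Phi> (S \<circ> T) = \<Phi> S \<circ> \<Phi> T) \<and>
    (\<forall>T\<in>\<AA>. positive_op T \<longrightarrow> positive_op (\<Phi> T))"

definition invertible_linear_on :: "'a::real_vector set \<Rightarrow> ('a \<Rightarrow> 'a) \<Rightarrow> bool"
  where "invertible_linear_on V P \<longleftrightarrow> linear_on V P \<and> bij_betw P V V"

text \<open>The operator \<open>P D S D\<^sup>-\<^sup>1 P\<^sup>-\<^sup>1\<close> on \<open>V\<close>, for \<open>P\<close> and \<open>D\<close> invertible on \<open>V\<close> and \<open>S\<close> mapping
  \<open>V\<close> into itself; only the values on \<open>V\<close> are meaningful.\<close>

definition conj_on ::
  "'a set \<Rightarrow> ('a \<Rightarrow> 'a) \<Rightarrow> ('a \<Rightarrow> 'a) \<Rightarrow> ('a \<Rightarrow> 'a) \<Rightarrow> 'a \<Rightarrow> 'a"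
  where "conj_on V P D S = P \<circ> D \<circ> S \<circ> inv_into V D \<circ> inv_into V P"

end

theory Submission
  imports Defs
begin

text \<open>The images \<open>Q\<^sub>a\<close> of the diagonal units \<open>a \<otimes> \<phi>\<^sub>a\<close> are pairwise orthogonal positive idempotents.
  Since \<open>Q\<^sub>a\<^sup>2 = Q\<^sub>a \<noteq> 0\<close> is order continuous, there is an atom \<open>c\<close> with \<open>Q\<^sub>a c \<noteq> 0\<close> and \<open>\<phi>\<^sub>c \<circ> Q\<^sub>a \<noteq> 0\<close>;
  positivity and orthogonality then force \<open>Q\<^sub>b c = 0\<close> and \<open>\<phi>\<^sub>c \<circ> Q\<^sub>b = 0\<close> for \<open>b \<noteq> a\<close>. So \<open>\<Phi>\<^sup>-\<^sup>1 (c \<otimes> \<phi>\<^sub>c)\<close>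
  is an idempotent living only on \<open>a\<close>, that is, it equals \<open>a \<otimes> \<phi>\<^sub>a\<close>, and \<open>\<pi>(a) = c\<close>. Compressing by the
  diagonal units gives \<open>\<Phi>(a \<otimes> \<phi>\<^sub>b) = \<mu>(a, b) \<pi>(a) \<otimes> \<phi>\<^bsub>\<pi>(b)\<^esub>\<close> with \<open>\<mu>(a, b) \<mu>(b, c) = \<mu>(a, c)\<close>, hence
  \<open>\<mu>(a, b) = \<delta>\<^sub>a / \<delta>\<^sub>b\<close>, and it determines the matrix of every \<open>\<Phi>(T)\<close>. The supremum formula is tested
  on the operators \<open>S = \<phi>\<^sub>a(T b) a \<otimes> \<phi>\<^sub>b \<le> T\<close>, because an inequality in \<open>X\<close> can be checked on coordinates.\<close>

section \<open>Disjointness and atoms\<close>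

lemma abs_scaleR_le: "\<bar>r *\<^sub>R x\<bar> \<le> \<bar>r\<bar> *\<^sub>R \<bar>x\<bar>" for x :: "'a::vector_lattice"
proof (cases "0 \<le> r")
  case True
  have "r *\<^sub>R x \<le> r *\<^sub>R \<bar>x\<bar>" "r *\<^sub>R (- x) \<le> r *\<^sub>R \<bar>x\<bar>"
    using True by (auto intro!: scaleR_left_mono abs_ge_self abs_ge_minus_self simp del: scaleR_minus_right)
  then show ?thesis using True by (intro abs_leI) auto
next
  case False
  then have "(- r) *\<^sub>R x \<le> (- r) *\<^sub>R \<bar>x\<bar>" "(- r) *\<^sub>R (- x) \<le> (- r) *\<^sub>R \<bar>x\<bar>"
    by (auto intro!: scaleR_left_mono abs_ge_self abs_ge_minus_self simp del: scaleR_minus_left scaleR_minus_right)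
  then show ?thesis using False by (intro abs_leI) auto
qed

text \<open>Translations distribute over \<open>inf\<close>, so the left side lies below both
  \<open>u + inf v w\<close> and \<open>w + inf v w\<close>, and the infimum of these two is the
  right side. This makes disjointness stable under sums.\<close>

lemma inf_add_le:
  fixes u v w :: "'a::vector_lattice"
  assumes "0 \<le> u" "0 \<le> v" "0 \<le> w"
  shows "inf (u + v) w \<le> inf u w + inf v w"
proof -
  have "inf (u + v) w \<le> u + inf v w"
    unfolding add_inf_distrib_left using assms by (intro inf_mono) simp_all
  moreover have "inf (u + v) w \<le> w + inf v w"
    using assms by (intro le_infI2) simp
  ultimately show ?thesis by (simp add: add_inf_distrib_right)
qed

lemma disjoint_vec_commute: "disjoint_vec x y \<longleftrightarrow> disjoint_vec y x"
  by (simp add: disjoint_vec_def inf_commute)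

lemma disjoint_vec_zero [simp]: "disjoint_vec 0 x"
  by (simp add: disjoint_vec_def inf_absorb1)

lemma disjoint_vec_self [simp]: "disjoint_vec x x \<longleftrightarrow> x = 0"
  by (simp add: disjoint_vec_def)

lemma disjoint_vec_mono:
  assumes "disjoint_vec x z" "\<bar>y\<bar> \<le> \<bar>x\<bar>"
  shows "disjoint_vec y z"
proof -
  have "inf \<bar>y\<bar> \<bar>z\<bar> \<le> inf \<bar>x\<bar> \<bar>z\<bar>" using assms(2) by (rule inf_mono) simp
  then show ?thesis using assms(1) unfolding disjoint_vec_def by (intro antisym) simp_all
qed

lemma disjoint_vec_add:
  assumes "disjoint_vec x z" "disjoint_vec y z"
  shows "disjoint_vec (x + y) z"
proof -
  have "inf (\<bar>x\<bar> + \<bar>y\<bar>) \<bar>z\<bar> \<le> inf \<bar>x\<bar> \<bar>z\<bar> + inf \<bar>y\<bar> \<bar>z\<bar>" by (rule inf_add_le) auto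
  then have "disjoint_vec (\<bar>x\<bar> + \<bar>y\<bar>) z" using assms by (auto simp: disjoint_vec_def intro: antisym)
  then show ?thesis by (rule disjoint_vec_mono) (simp add: abs_triangle_ineq)
qed

text \<open>A real factor is bounded by a natural number \<open>n\<close>, and the multiple by
  \<open>n\<close> is a sum of \<open>n\<close> copies, so stability under sums suffices.\<close>

lemma disjoint_vec_scaleR:
  assumes "disjoint_vec x z"
  shows "disjoint_vec (r *\<^sub>R x) z"
proof -
  obtain n where n': "\<bar>r\<bar> \<le> real n" using real_arch_simple by blast
  have "\<bar>r *\<^sub>R x\<bar> \<le> \<bar>r\<bar> *\<^sub>R \<bar>x\<bar>" by (rule abs_scaleR_le)
  also have "\<dots> \<le> real n *\<^sub>R \<bar>x\<bar>" using n' by (intro scaleR_right_mono) auto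
  finally have le: "\<bar>r *\<^sub>R x\<bar> \<le> real n *\<^sub>R \<bar>x\<bar>" .
  have "disjoint_vec \<bar>x\<bar> z" using assms by (simp add: disjoint_vec_def)
  then have "disjoint_vec (real m *\<^sub>R \<bar>x\<bar>) z" for m
  proof (induction m)
    case (Suc m)
    then show ?case using disjoint_vec_add[of "\<bar>x\<bar>" z] by (simp add: scaleR_add_left)
  qed simp
  moreover have "\<bar>real n *\<^sub>R \<bar>x\<bar>\<bar> = real n *\<^sub>R \<bar>x\<bar>" by (simp add: scaleR_nonneg_nonneg)
  ultimately show ?thesis using le by (metis disjoint_vec_mono)
qed

lemma subspace_disjoint_complement: "subspace {x. disjoint_vec x z}"
  by (auto simp: subspace_def disjoint_vec_add disjoint_vec_scaleR)

lemma disjoint_vec_diff: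
  "disjoint_vec x z \<Longrightarrow> disjoint_vec y z \<Longrightarrow> disjoint_vec (x - y) z"
  using subspace_diff[OF subspace_disjoint_complement] by fastforce

lemma disjoint_vec_nonneg: "0 \<le> x \<Longrightarrow> 0 \<le> y \<Longrightarrow> disjoint_vec x y \<longleftrightarrow> inf x y = 0"
  by (simp add: disjoint_vec_def)

text \<open>For the second identity, subtracting the negative part from the infimum of the two parts
  leaves \<open>inf x 0\<close>, which is minus the negative part.\<close>

lemma pos_neg_parts:
  fixes x :: "'a::vector_lattice"
  shows "x = sup x 0 - sup (- x) 0" and "inf (sup x 0) (sup (- x) 0) = 0"
proof -
  have n: "- sup (- x) 0 = inf x 0" by (simp add: neg_sup_eq_inf)
  have "sup x 0 + inf x 0 = x" using prts[of x] unfolding pprt_def nprt_def by (rule sym)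
  then show x: "x = sup x 0 - sup (- x) 0" unfolding diff_conv_add_uminus n by (rule sym)
  have "inf (sup x 0) (sup (- x) 0) + - sup (- x) 0 = inf (sup x 0 - sup (- x) 0) 0"
    by (simp only: add_inf_distrib_right diff_conv_add_uminus right_minus)
  also have "\<dots> = inf x 0" by (simp only: x[symmetric])
  also have "\<dots> = - sup (- x) 0" by (rule n[symmetric])
  finally show "inf (sup x 0) (sup (- x) 0) = 0" by simp
qed

lemma sup_neg_le_abs: "sup x 0 \<le> \<bar>x\<bar>" "sup (- x) 0 \<le> \<bar>x\<bar>" for x :: "'a::vector_lattice"
  by (auto simp: abs_ge_self abs_ge_minus_self)

text \<open>Only closure under suprema needs work. The overlap \<open>w\<close> of the positive part
  of \<open>s\<close> with \<open>z\<close> can be subtracted from \<open>s\<close> without losing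
  the upper bound property, so leastness of \<open>s\<close> forces \<open>w = 0\<close>.\<close>

lemma band_disjoint_complement:
  fixes z :: "'a::vector_lattice"
  shows "band {x. disjoint_vec x z}"
proof -
  have "lattice_ideal {x. disjoint_vec x z}"
    unfolding lattice_ideal_def using subspace_disjoint_complement disjoint_vec_mono by blast
  moreover have "disjoint_vec s z"
    if E: "E \<subseteq> {x. disjoint_vec x z}" "E \<noteq> {}" and ub: "\<forall>x\<in>E. x \<le> s"
      and least: "\<forall>u. (\<forall>x\<in>E. x \<le> u) \<longrightarrow> s \<le> u" for E s
  proof -
    define w where "w = inf (sup s 0) \<bar>z\<bar>"
    have w0: "0 \<le> w" unfolding w_def by simp
    have "e \<le> s - w" if e: "e \<in> E" for e
    proof -
      have es: "e \<le> s" using ub e by blast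
      have "disjoint_vec (sup e 0) z"
        using E(1) e disjoint_vec_mono[of e z "sup e 0"] sup_neg_le_abs(1)[of e] by auto
      then have "inf (sup e 0) \<bar>z\<bar> = 0" by (simp add: disjoint_vec_def)
      moreover have "inf (sup e 0) w \<le> inf (sup e 0) \<bar>z\<bar>" unfolding w_def by (intro inf_mono) auto
      ultimately have "inf (sup e 0) w = 0" using w0 by (intro antisym) simp_all
      \<comment> \<open>For disjoint positive elements the sum is the supremum, and here both terms
        lie below the positive part of \<open>s\<close>.\<close>
      then have "sup e 0 + w = sup (sup e 0) w" using add_eq_inf_sup[of "sup e 0" w] by simp
      also have "\<dots> \<le> sup s 0" unfolding w_def using es by (auto intro: le_supI1 sup_mono)
      finally have 1: "sup e 0 + w \<le> sup s 0" .
      have 2: "sup (- s) 0 \<le> sup (- e) 0" using es by (intro sup_mono) simp_all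
      have "e = sup e 0 - sup (- e) 0" by (rule pos_neg_parts)
      also have "\<dots> \<le> (sup s 0 - w) - sup (- s) 0"
        using 1 2 by (intro diff_mono) (simp_all add: le_diff_eq)
      also have "\<dots> = (sup s 0 - sup (- s) 0) - w" by (rule diff_right_commute)
      also have "\<dots> = s - w" by (simp only: pos_neg_parts(1)[symmetric])
      finally show ?thesis .
    qed
    then have "s \<le> s - w" using least by blast
    then have "w = 0" using w0 by (simp add: antisym)
    then have p: "disjoint_vec (sup s 0) z" unfolding w_def by (simp add: disjoint_vec_def)
    \<comment> \<open>Nonemptiness enters here: a single element of \<open>E\<close> controls the
      negative part of \<open>s\<close>.\<close>
    obtain e where e: "e \<in> E" using E by blast
    have "sup (- s) 0 \<le> sup (- e) 0" using ub e by (intro sup_mono) simp_all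
    also have "\<dots> \<le> \<bar>e\<bar>" by (rule sup_neg_le_abs)
    finally have "disjoint_vec (sup (- s) 0) z"
      using E e disjoint_vec_mono[of e z "sup (- s) 0"] by auto
    from disjoint_vec_diff[OF p this] show ?thesis unfolding pos_neg_parts(1)[symmetric] .
  qed
  ultimately show ?thesis unfolding band_def by blast
qed

section \<open>Atoms and components along an atom\<close>

lemma atomD:
  assumes "atom a"
  shows "0 \<le> a" "a \<noteq> 0"
    "0 \<le> x \<Longrightarrow> x \<le> a \<Longrightarrow> 0 \<le> y \<Longrightarrow> y \<le> a \<Longrightarrow> disjoint_vec x y \<Longrightarrow> x = 0 \<or> y = 0"
  using assms unfolding atom_def by blast+

lemma atom_mono: "atom a \<Longrightarrow> 0 \<le> w \<Longrightarrow> w \<le> a \<Longrightarrow> w \<noteq> 0 \<Longrightarrow> atom w"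
  unfolding atom_def by (meson order_trans)

text \<open>If an atom \<open>b\<close> met \<open>x\<close>, then the infimum of \<open>b\<close>
  and the modulus of \<open>x\<close> would be an atom disjoint from all of \<open>A\<close>,
  contradicting maximality. So all atoms lie in the band of vectors disjoint from \<open>x\<close>;
  by atomicity this band contains \<open>x\<close> itself.\<close>

lemma disjoint_maximal_atoms_imp_zero:
  fixes x :: "'a::vector_lattice"
  assumes "atomic_lattice TYPE('a)" "maximal_disjoint_atoms A"
    and x: "\<And>c. c \<in> A \<Longrightarrow> disjoint_vec x c"
  shows "x = 0"
proof -
  have "disjoint_vec b x" if b: "atom b" for b
  proof (rule ccontr)
    define w where "w = inf \<bar>b\<bar> \<bar>x\<bar>"
    assume "\<not> disjoint_vec b x"
    then have w: "w \<noteq> 0" "0 \<le> w" "w \<le> b" "\<bar>w\<bar> \<le> \<bar>x\<bar>"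
      using atomD(1)[OF b] unfolding disjoint_vec_def w_def by auto
    then have wd: "disjoint_vec w c" if "c \<in> A" for c using x that disjoint_vec_mono by blast
    have "disjoint_atoms (insert w A)"
      using assms(2) atom_mono[OF b w(2,3,1)] wd
      unfolding maximal_disjoint_atoms_def disjoint_atoms_def
      by (auto simp: pairwise_insert disjoint_vec_commute)
    then have "w \<in> A" using assms(2) unfolding maximal_disjoint_atoms_def by blast
    then have "disjoint_vec w w" by (rule wd)
    then show False using w(1) by simp
  qed
  then have "band hull {a::'a. atom a} \<subseteq> {y. disjoint_vec y x}"
    by (intro hull_minimal band_disjoint_complement) auto
  then have "x \<in> {y. disjoint_vec y x}" using assms(1) unfolding atomic_lattice_def by blast
  then show ?thesis by simp
qed

text \<open>The Archimedean axiom in terms of small multiples: take \<open>e = 1/n\<close>, and for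
  \<open>n = 0\<close> use \<open>0 \<le> a\<close>.\<close>

lemma le_0_if_le_small_scaleR:
  fixes a :: "'a::archimedean_vector_lattice"
  assumes "0 \<le> a" "\<And>e. 0 < e \<Longrightarrow> w \<le> e *\<^sub>R a"
  shows "w \<le> 0"
proof (rule archimedean[of _ a])
  fix n :: nat
  show "real n *\<^sub>R w \<le> a"
  proof (cases n)
    case (Suc m)
    then have "real n *\<^sub>R w \<le> real n *\<^sub>R (inverse (real n) *\<^sub>R a)"
      by (intro scaleR_left_mono assms) auto
    then show ?thesis using Suc by simp
  qed (use assms in simp)
qed

text \<open>The coefficient is the largest \<open>r\<close> with \<open>r a\<close> below
  \<open>x\<close>. The Archimedean axiom shows that it is finite and attained, and the atom
  property shows that nothing of \<open>a\<close> is left in the remainder.\<close>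

lemma atom_component_nonneg:
  fixes a :: "'a::archimedean_vector_lattice"
  assumes a: "atom a" and x: "0 \<le> x"
  obtains r where "0 \<le> r" "r *\<^sub>R a \<le> x" "disjoint_vec (x - r *\<^sub>R a) a"
proof -
  note a0 = atomD(1)[OF a]
  define M where "M = {t. t *\<^sub>R a \<le> x}"
  have "\<not> a \<le> 0" using a0 atomD(2)[OF a] by (meson antisym)
  then obtain n :: nat where n: "\<not> real n *\<^sub>R a \<le> x" using archimedean[of a x] by blast
  have "t \<le> real n" if "t \<in> M" for t
  proof (rule ccontr)
    assume "\<not> t \<le> real n"
    then have "real n *\<^sub>R a \<le> t *\<^sub>R a" using a0 by (intro scaleR_right_mono) auto
    then show False using that n order_trans unfolding M_def by blast
  qed
  then have bdd: "bdd_above M" by (rule bdd_aboveI)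
  have M0: "0 \<in> M" unfolding M_def using x by simp
  define r where "r = Sup M"
  have r0: "0 \<le> r" unfolding r_def using bdd M0 by (rule cSup_upper[rotated])
  have "r *\<^sub>R a - x \<le> 0"
  proof (rule le_0_if_le_small_scaleR[OF a0])
    fix e :: real assume "0 < e"
    then obtain t where t: "t \<in> M" "r - e < t"
      using less_cSupD[of M "r - e"] M0 unfolding r_def by auto
    have "(r - e) *\<^sub>R a \<le> t *\<^sub>R a" using a0 t by (intro scaleR_right_mono) auto
    also have "\<dots> \<le> x" using t unfolding M_def by simp
    finally show "r *\<^sub>R a - x \<le> e *\<^sub>R a" by (simp add: algebra_simps)
  qed
  then have le: "r *\<^sub>R a \<le> x" by simp
  define w where "w = inf (x - r *\<^sub>R a) a"
  have w: "0 \<le> w" "w \<le> a" "w \<le> x - r *\<^sub>R a" unfolding w_def using le a0 by auto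
  \<comment> \<open>The bound \<open>e \<le> 1\<close> keeps the negative part of
    \<open>w - e a\<close> below \<open>a\<close>, as its positive part is anyway, so the atom
    property makes one of these disjoint parts vanish. If it were the negative one,
    \<open>r + e\<close> would belong to \<open>M\<close>.\<close>
  have small: "w \<le> e *\<^sub>R a" if e: "0 < e" "e \<le> 1" for e
  proof -
    have ea: "0 \<le> e *\<^sub>R a" "e *\<^sub>R a \<le> a"
      using e a0 scaleR_right_mono[of e 1 a] by (auto intro: scaleR_nonneg_nonneg)
    define p where "p = sup (w - e *\<^sub>R a) 0"
    define q where "q = sup (- (w - e *\<^sub>R a)) 0"
    have "w - e *\<^sub>R a \<le> w" using ea(1) by simp
    then have "w - e *\<^sub>R a \<le> a" using w(2) by (rule order_trans)
    moreover have "- (w - e *\<^sub>R a) \<le> a"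
      using add_mono[OF ea(2) w(1)] by (simp add: algebra_simps)
    ultimately have pq: "0 \<le> p" "p \<le> a" "0 \<le> q" "q \<le> a"
      unfolding p_def q_def using a0 by auto
    moreover have "inf p q = 0" unfolding p_def q_def by (rule pos_neg_parts)
    ultimately have "p = 0 \<or> q = 0" using atomD(3)[OF a] disjoint_vec_nonneg by blast
    moreover have "q \<noteq> 0"
    proof
      assume "q = 0"
      then have "e *\<^sub>R a \<le> w" unfolding q_def by (metis sup_ge1 neg_le_0_iff_le diff_ge_0_iff_ge)
      then have "e *\<^sub>R a \<le> x - r *\<^sub>R a" using w(3) by (rule order_trans)
      then have "r + e \<in> M" unfolding M_def by (simp add: algebra_simps)
      then show False using cSup_upper[OF _ bdd] e unfolding r_def by fastforce
    qed
    ultimately have "p = 0" by blast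
    then have "w - e *\<^sub>R a \<le> 0" unfolding p_def by (metis sup_ge1)
    then show ?thesis by simp
  qed
  have "w \<le> 0"
  proof (rule le_0_if_le_small_scaleR[OF a0])
    fix e :: real assume "0 < e"
    then have "w \<le> min e 1 *\<^sub>R a" by (intro small) auto
    also have "\<dots> \<le> e *\<^sub>R a" using a0 by (intro scaleR_right_mono) auto
    finally show "w \<le> e *\<^sub>R a" .
  qed
  then have "w = 0" using w(1) by (rule antisym)
  then have "disjoint_vec (x - r *\<^sub>R a) a"
    unfolding w_def using le a0 by (simp add: disjoint_vec_nonneg)
  then show thesis using that r0 le by blast
qed

section \<open>Coordinate functionals\<close>

text \<open>Two different candidates would differ by a nonzero multiple of \<open>a\<close> that is
  disjoint from \<open>a\<close>. This makes the definite description in \<open>coord\<close>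
  usable.\<close>

lemma coord_unique:
  fixes a :: "'a::archimedean_vector_lattice"
  assumes a: "atom a" and r: "disjoint_vec (x - r *\<^sub>R a) a"
  shows "coord a x = r"
  unfolding coord_def
proof (rule the_equality[where P = "\<lambda>r. disjoint_vec (x - r *\<^sub>R a) a", OF r])
  fix s assume "disjoint_vec (x - s *\<^sub>R a) a"
  from disjoint_vec_diff[OF this r] have d: "disjoint_vec ((r - s) *\<^sub>R a) a"
    by (simp add: algebra_simps)
  show "s = r"
  proof (rule ccontr)
    assume "s \<noteq> r"
    then have "disjoint_vec a a" using disjoint_vec_scaleR[OF d, of "inverse (r - s)"] by simp
    then show False using atomD(2)[OF a] by simp
  qed
qed

lemma coord_nonneg:
  fixes a :: "'a::archimedean_vector_lattice"
  assumes a: "atom a" and x: "0 \<le> x"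
  shows "0 \<le> coord a x" "coord a x *\<^sub>R a \<le> x"
proof -
  obtain r where r: "0 \<le> r" "r *\<^sub>R a \<le> x" "disjoint_vec (x - r *\<^sub>R a) a"
    using atom_component_nonneg[OF a x] .
  then show "0 \<le> coord a x" "coord a x *\<^sub>R a \<le> x" using coord_unique[OF a r(3)] by simp_all
qed

text \<open>Existence for vectors of arbitrary sign: subtract the components of the positive and
  negative parts.\<close>

lemma coord_disjoint:
  fixes a :: "'a::archimedean_vector_lattice"
  assumes a: "atom a"
  shows "disjoint_vec (x - coord a x *\<^sub>R a) a"
proof -
  obtain r where r: "disjoint_vec (sup x 0 - r *\<^sub>R a) a"
    using atom_component_nonneg[OF a, of "sup x 0"] by auto
  obtain s where s: "disjoint_vec (sup (- x) 0 - s *\<^sub>R a) a"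
    using atom_component_nonneg[OF a, of "sup (- x) 0"] by auto
  have "disjoint_vec ((sup x 0 - sup (- x) 0) - (r - s) *\<^sub>R a) a"
    using disjoint_vec_diff[OF r s] by (simp add: algebra_simps)
  then have "disjoint_vec (x - (r - s) *\<^sub>R a) a" unfolding pos_neg_parts(1)[symmetric] .
  with coord_unique[OF a this] show ?thesis by simp
qed

lemma linear_coord:
  fixes a :: "'a::archimedean_vector_lattice"
  assumes a: "atom a"
  shows "linear (coord a)"
proof (rule linearI)
  fix x y r
  show "coord a (x + y) = coord a x + coord a y"
    using disjoint_vec_add[OF coord_disjoint[OF a, of x] coord_disjoint[OF a, of y]]
    by (intro coord_unique[OF a]) (simp add: algebra_simps)
  show "coord a (r *\<^sub>R x) = r *\<^sub>R coord a x"
    using disjoint_vec_scaleR[OF coord_disjoint[OF a, of x], of r]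
    by (intro coord_unique[OF a]) (simp add: algebra_simps)
qed

lemma coord_eq_0_iff:
  fixes a :: "'a::archimedean_vector_lattice"
  assumes a: "atom a"
  shows "coord a x = 0 \<longleftrightarrow> disjoint_vec x a"
  using coord_disjoint[OF a, of x] coord_unique[OF a, of x 0] by auto

lemma coord_self [simp]: "atom a \<Longrightarrow> coord a a = 1" for a :: "'a::archimedean_vector_lattice"
  by (rule coord_unique) (auto simp: disjoint_vec_def inf_absorb1)

text \<open>The coordinate \<open>q\<close> of the negative part is at most that of the positive
  part, so \<open>q a\<close> lies below both parts, which are disjoint, and hence vanishes. This
  fragment of the lattice homomorphism property is what permits comparing vectors by
  coordinates.\<close>

lemma coord_neg_part:
  fixes a :: "'a::archimedean_vector_lattice"
  assumes a: "atom a" and x: "0 \<le> coord a x"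
  shows "coord a (sup (- x) 0) = 0"
proof -
  define p q where "p = coord a (sup x 0)" and "q = coord a (sup (- x) 0)"
  have q0: "0 \<le> q" unfolding q_def by (rule coord_nonneg[OF a]) simp
  have "coord a x = p - q"
    unfolding p_def q_def linear_diff[OF linear_coord[OF a], symmetric] pos_neg_parts(1)[symmetric] ..
  then have qp: "q \<le> p" using x by simp
  have "q *\<^sub>R a \<le> p *\<^sub>R a" using qp atomD(1)[OF a] by (rule scaleR_right_mono)
  also have "\<dots> \<le> sup x 0" unfolding p_def by (rule coord_nonneg[OF a]) simp
  finally have "q *\<^sub>R a \<le> sup x 0" .
  moreover have "q *\<^sub>R a \<le> sup (- x) 0" unfolding q_def by (rule coord_nonneg[OF a]) simp
  ultimately have "q *\<^sub>R a \<le> 0" using pos_neg_parts(2)[of x] by (metis le_inf_iff)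
  moreover have "0 \<le> q *\<^sub>R a" using q0 atomD(1)[OF a] by (rule scaleR_nonneg_nonneg)
  ultimately have "q *\<^sub>R a = 0" by (rule antisym)
  then show ?thesis using atomD(2)[OF a] unfolding q_def by simp
qed

section \<open>Operators and spans\<close>

lemma linear_onD:
  assumes "linear_on V T"
  shows "x \<in> V \<Longrightarrow> y \<in> V \<Longrightarrow> T (x + y) = T x + T y" "x \<in> V \<Longrightarrow> T (r *\<^sub>R x) = r *\<^sub>R T x"
  using assms unfolding linear_on_def by blast+

lemma linear_imp_linear_on: "linear T \<Longrightarrow> linear_on V T"
  by (simp add: linear_on_def linear_add linear_scale)

lemma linear_on_0: "linear_on V T \<Longrightarrow> subspace V \<Longrightarrow> T 0 = 0"
  using linear_onD(2)[of V T 0 0] by (simp add: subspace_0)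

lemma linear_on_sum_scaleR:
  assumes "linear_on V T" "subspace V" "finite F" "F \<subseteq> V"
  shows "T (\<Sum>c\<in>F. f c *\<^sub>R c) = (\<Sum>c\<in>F. f c *\<^sub>R T c)"
  using assms(3,4)
proof (induction F)
  case empty
  then show ?case using linear_on_0[OF assms(1,2)] by simp
next
  case (insert c F)
  then have "(\<Sum>c\<in>F. f c *\<^sub>R c) \<in> V" "f c *\<^sub>R c \<in> V" "c \<in> V"
    using assms(2) by (auto intro!: subspace_sum subspace_scale)
  then show ?case using insert linear_onD[OF assms(1)] by simp
qed

lemma positive_op_iff: "positive_op T \<longleftrightarrow> (\<forall>x. 0 \<le> x \<longrightarrow> 0 \<le> T x)"
  by (simp add: op_le_def)

lemma positive_op_mono:
  "linear T \<Longrightarrow> positive_op T \<Longrightarrow> x \<le> y \<Longrightarrow> T x \<le> T y"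
  by (metis positive_op_iff diff_ge_0_iff_ge linear_diff)

lemma linear_eq_0_on_cone:
  fixes T :: "'a::vector_lattice \<Rightarrow> 'b::real_vector"
  assumes "linear T" "\<And>x. 0 \<le> x \<Longrightarrow> T x = 0"
  shows "T x = 0"
proof -
  have "T (sup x 0 - sup (- x) 0) = 0" by (simp only: linear_diff[OF assms(1)] assms(2) sup_ge2) simp
  then show ?thesis unfolding pos_neg_parts(1)[symmetric] .
qed

text \<open>Two linear maps that invert each other on generators do so on the span. It serves to
  replace \<open>inv_into\<close> of the operators \<open>P\<close> and \<open>D\<close> by explicit
  linear maps.\<close>

lemma bij_betw_span_of_inverse:
  assumes f: "linear f" "\<And>a. a \<in> A \<Longrightarrow> f a \<in> span A"
    and g: "linear g" "\<And>a. a \<in> A \<Longrightarrow> g a \<in> span A"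
    and fg: "\<And>a. a \<in> A \<Longrightarrow> g (f a) = a" "\<And>a. a \<in> A \<Longrightarrow> f (g a) = a"
  shows "bij_betw f (span A) (span A)"
    and "x \<in> span A \<Longrightarrow> g x \<in> span A"
    and "x \<in> span A \<Longrightarrow> inv_into (span A) f x = g x"
proof -
  have into: "h y \<in> span A" if h: "linear h" "\<And>a. a \<in> A \<Longrightarrow> h a \<in> span A" "y \<in> span A" for h y
  proof -
    have "h ` A \<subseteq> span A" using h(2) by blast
    then have "span (h ` A) \<subseteq> span A" by (simp add: span_minimal)
    then show ?thesis using h(3) linear_span_image[OF h(1)] by blast
  qed
  have gf: "g (f y) = y" "f (g y) = y" if "y \<in> span A" for y
    using linear_eq_on_span[OF linear_compose[OF f(1) g(1)] linear_id _ that]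
      linear_eq_on_span[OF linear_compose[OF g(1) f(1)] linear_id _ that] fg
    by simp_all
  show bij: "bij_betw f (span A) (span A)"
    by (rule bij_betw_byWitness[where f' = g]) (auto simp: gf into f g)
  show gx: "g x \<in> span A" if "x \<in> span A" using into g that by blast
  show "inv_into (span A) f x = g x" if "x \<in> span A"
    using bij gx[OF that] gf(2)[OF that] by (metis bij_betw_inv_into_left)
qed

section \<open>Maximal families of atoms\<close>

locale maximal_atoms =
  fixes A :: "'a::archimedean_vector_lattice set"
  assumes atomic: "atomic_lattice TYPE('a)" and maximal: "maximal_disjoint_atoms A"
begin

lemma atom_mem: "a \<in> A \<Longrightarrow> atom a"
  using maximal by (simp add: maximal_disjoint_atoms_def disjoint_atoms_def)

lemma nonneg_mem: "a \<in> A \<Longrightarrow> 0 \<le> a"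
  and nonzero_mem: "a \<in> A \<Longrightarrow> a \<noteq> 0"
  using atomD(1,2)[OF atom_mem] by simp_all

lemma coord_mem:
  assumes "a \<in> A" "b \<in> A"
  shows "coord a b = (if a = b then 1 else 0)"
proof -
  have "pairwise disjoint_vec A"
    using maximal by (simp add: maximal_disjoint_atoms_def disjoint_atoms_def)
  then have "coord a b = 0" if "a \<noteq> b"
    using coord_eq_0_iff[OF atom_mem[OF assms(1)]] pairwiseD[of disjoint_vec A b a] assms that by simp
  then show ?thesis using coord_self[OF atom_mem[OF assms(1)]] by auto
qed

section \<open>Vectors and their order tested on coordinates\<close>

lemma eq_0_if_coord_eq_0: "(\<And>c. c \<in> A \<Longrightarrow> coord c x = 0) \<Longrightarrow> x = 0"
  by (rule disjoint_maximal_atoms_imp_zero[OF atomic maximal]) (simp flip: coord_eq_0_iff add: atom_mem)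

text \<open>Every coordinate of the negative part vanishes, so the negative part is zero by
  atomicity.\<close>

lemma nonneg_if_coord_nonneg:
  assumes "\<And>c. c \<in> A \<Longrightarrow> 0 \<le> coord c x"
  shows "0 \<le> x"
proof -
  have "sup (- x) 0 = 0"
    by (rule eq_0_if_coord_eq_0) (rule coord_neg_part[OF atom_mem assms])
  with sup_ge1[of "- x" 0] show ?thesis by simp
qed

lemma coord_linear:
  assumes "a \<in> A"
  shows "coord a (x + y) = coord a x + coord a y" "coord a (x - y) = coord a x - coord a y"
    "coord a (r *\<^sub>R x) = r * coord a x" "coord a 0 = 0"
    "coord a (sum f F) = (\<Sum>i\<in>F. coord a (f i))"
proof -
  note l = linear_coord[OF atom_mem[OF assms]]
  show "coord a (x + y) = coord a x + coord a y" "coord a (x - y) = coord a x - coord a y"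
    "coord a (r *\<^sub>R x) = r * coord a x" "coord a 0 = 0"
    "coord a (sum f F) = (\<Sum>i\<in>F. coord a (f i))"
    using linear_add[OF l] linear_diff[OF l] linear_scale[OF l] linear_0[OF l] linear_sum[OF l]
    by simp_all
qed

lemma le_if_coord_le: "(\<And>c. c \<in> A \<Longrightarrow> coord c x \<le> coord c y) \<Longrightarrow> x \<le> y"
  using nonneg_if_coord_nonneg[of "y - x"] by (simp add: coord_linear)

lemma eq_if_coord_eq: "(\<And>c. c \<in> A \<Longrightarrow> coord c x = coord c y) \<Longrightarrow> x = y"
  using eq_0_if_coord_eq_0[of "x - y"] by (simp add: coord_linear)

lemma coord_mono: "a \<in> A \<Longrightarrow> x \<le> y \<Longrightarrow> coord a x \<le> coord a y"
  using coord_nonneg(1)[OF atom_mem, of a "y - x"] by (simp add: coord_linear)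

lemma coord_sum_mem:
  assumes "a \<in> A" "F \<subseteq> A" "finite F"
  shows "coord a (\<Sum>c\<in>F. f c *\<^sub>R c) = (if a \<in> F then f a else 0)"
proof -
  have "coord a (\<Sum>c\<in>F. f c *\<^sub>R c) = (\<Sum>c\<in>F. if a = c then f c else 0)"
    unfolding coord_linear(5)[OF assms(1)]
    using assms by (intro sum.cong) (auto simp: coord_linear coord_mem)
  then show ?thesis using assms by simp
qed

lemma span_mem_expansion:
  assumes "x \<in> span A"
  obtains F where "finite F" "F \<subseteq> A" "x = (\<Sum>c\<in>F. coord c x *\<^sub>R c)"
proof -
  obtain F r where F: "finite F" "F \<subseteq> A" "x = (\<Sum>c\<in>F. r c *\<^sub>R c)"
    using assms unfolding span_explicit by blast
  then have "coord c x = r c" if "c \<in> F" for c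
    using coord_sum_mem[of c F r] that by auto
  then have eq: "(\<Sum>c\<in>F. coord c x *\<^sub>R c) = (\<Sum>c\<in>F. r c *\<^sub>R c)" by (intro sum.cong) simp_all
  show thesis using that[OF F(1,2) trans[OF F(3) eq[symmetric]]] .
qed

text \<open>The coordinate functionals are biorthogonal to \<open>A\<close>. Independence allows
  linear operators to be defined by prescribing their values on \<open>A\<close>.\<close>

lemma independent_atoms: "independent A"
proof -
  have "r v = 0" if "finite F" "F \<subseteq> A" "(\<Sum>c\<in>F. r c *\<^sub>R c) = 0" "v \<in> F" for F r v
    using coord_sum_mem[of v F r] that coord_linear(4)[of v] by auto
  then show ?thesis unfolding dependent_explicit by blast
qed

text \<open>The net of finite partial sums of the atomic expansion of \<open>y\<close> increases to \<open>y\<close>.\<close>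

lemma order_continuous_eq_0_nonneg:
  assumes T: "order_continuous_op T" and y: "0 \<le> y"
    and zero: "\<And>c. c \<in> A \<Longrightarrow> coord c y \<noteq> 0 \<Longrightarrow> T c = 0"
  shows "T y = 0"
proof -
  define J where "J = {F. finite F \<and> F \<subseteq> A}"
  define r where "r F = y - (\<Sum>c\<in>F. coord c y *\<^sub>R c)" for F
  have lin: "linear T" using T by (simp add: order_continuous_op_def)
  have coord_r: "coord c (r F) = (if c \<in> F then 0 else coord c y)" if "c \<in> A" "F \<in> J" for c F
    using that coord_sum_mem[of c F "\<lambda>c. coord c y"] unfolding r_def J_def
    by (simp add: coord_linear)
  have y0: "0 \<le> coord c y" if "c \<in> A" for c using coord_nonneg(1)[OF atom_mem[OF that] y] .
  have dir: "directed_index J (\<subseteq>)" unfolding directed_index_def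
  proof (intro conjI ballI)
    fix F G assume "F \<in> J" "G \<in> J"
    then have "F \<union> G \<in> J" unfolding J_def by auto
    then show "\<exists>k\<in>J. F \<subseteq> k \<and> G \<subseteq> k" by blast
  qed (auto simp: J_def)
  have r0: "0 \<le> r F" if "F \<in> J" for F
    using that by (intro nonneg_if_coord_nonneg) (simp add: coord_r y0)
  have mono: "r G \<le> r F" if "F \<in> J" "G \<in> J" "F \<subseteq> G" for F G
    using that by (intro le_if_coord_le) (auto simp: coord_r y0)
  \<comment> \<open>The remainder \<open>r {c}\<close> has coordinate zero at \<open>c\<close>, so
    no coordinate of a common lower bound can be positive.\<close>
  have least: "z \<le> 0" if z: "\<forall>F\<in>J. z \<le> r F" for z
  proof (rule le_if_coord_le)
    fix c assume c: "c \<in> A"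
    then have "{c} \<in> J" unfolding J_def by simp
    then show "coord c z \<le> coord c 0"
      using coord_mono[OF c, of z "r {c}"] z coord_r[OF c, of "{c}"] c by (simp add: coord_linear)
  qed
  have dec: "decreases_to_0 J (\<subseteq>) r"
    unfolding decreases_to_0_def by (intro conjI ballI allI impI dir r0 mono least) simp_all
  \<comment> \<open>The decreasing net of remainders serves as its own dominating net.\<close>
  have "dominated_by J (\<subseteq>) r 0 J r" unfolding dominated_by_def
  proof
    fix F assume F: "F \<in> J"
    have "\<bar>r G - 0\<bar> \<le> r F" if "G \<in> J" "F \<subseteq> G" for G
      using r0[OF that(1)] mono[OF F that] by simp
    then show "\<exists>G\<in>J. \<forall>H\<in>J. G \<subseteq> H \<longrightarrow> \<bar>r H - 0\<bar> \<le> r F" using F by blast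
  qed
  then have "converges_in_order J (\<subseteq>) r 0" by (rule converges_in_orderI[OF dec])
  then have "converges_in_order J (\<subseteq>) (\<lambda>F. T (r F)) 0" by (rule order_continuous_opD[OF T dir])
  then obtain K :: "'a set" and leK k where
    K: "decreases_to_0 K leK k" and dom: "dominated_by J (\<subseteq>) (\<lambda>F. T (r F)) 0 K k"
    unfolding converges_in_order_def by blast
  \<comment> \<open>Only members of \<open>A\<close> killed by \<open>T\<close> occur in the partial
    sums, so the net \<open>T (r F)\<close> is constant with value \<open>T y\<close>; since it
    converges to \<open>0\<close>, this value is zero.\<close>
  have Tr: "T (r F) = T y" if "F \<in> J" for F
  proof -
    have "T (\<Sum>c\<in>F. coord c y *\<^sub>R c) = (\<Sum>c\<in>F. coord c y *\<^sub>R T c)"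
      by (simp add: linear_sum[OF lin] linear_scale[OF lin])
    also have "\<dots> = 0" using zero that unfolding J_def by (intro sum.neutral) auto
    finally show ?thesis unfolding r_def by (simp add: linear_diff[OF lin])
  qed
  have "\<bar>T y\<bar> \<le> k i" if i: "i \<in> K" for i
  proof -
    obtain F where F: "F \<in> J" "\<forall>G\<in>J. F \<subseteq> G \<longrightarrow> \<bar>T (r G) - 0\<bar> \<le> k i"
      using bspec[OF dom[unfolded dominated_by_def] i] ..
    have "\<bar>T (r F) - 0\<bar> \<le> k i" using bspec[OF F(2,1)] by simp
    then show ?thesis using Tr[OF F(1)] by simp
  qed
  moreover have "\<forall>z. (\<forall>i\<in>K. z \<le> k i) \<longrightarrow> z \<le> 0" using K by (simp add: decreases_to_0_def)
  ultimately have "\<bar>T y\<bar> \<le> 0" by blast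
  then show ?thesis by simp
qed

lemma order_continuous_eq_0:
  assumes "order_continuous_op T" "\<And>c. c \<in> A \<Longrightarrow> T c = 0"
  shows "T x = 0"
proof (rule linear_eq_0_on_cone[of T])
  show "linear T" using assms(1) by (simp add: order_continuous_op_def)
  fix y :: 'a assume "0 \<le> y"
  then show "T y = 0" using assms(2) by (rule order_continuous_eq_0_nonneg[OF assms(1)])
qed

end

section \<open>The automorphism on the matrix units\<close>

text \<open>The matrix units: for members of \<open>A\<close>, it sends \<open>b\<close> to
  \<open>a\<close> and the rest of \<open>A\<close> to zero.\<close>

abbreviation unit_op :: "'a::vector_lattice \<Rightarrow> 'a \<Rightarrow> 'a \<Rightarrow> 'a"
  where "unit_op a b \<equiv> rank_one a (coord b)"

locale automorphism_setup = maximal_atoms A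
  for A :: "'a::archimedean_vector_lattice set" +
  fixes \<AA> :: "('a \<Rightarrow> 'a) set" and \<Phi> :: "('a \<Rightarrow> 'a) \<Rightarrow> ('a \<Rightarrow> 'a)"
  assumes subalgebra: "subalgebra_of_Ln \<AA>"
    and finite_rank: "finite_rank_alg A \<subseteq> \<AA>"
    and automorphism: "positive_algebra_automorphism \<AA> \<Phi>"
begin

lemma order_continuous_mem: "T \<in> \<AA> \<Longrightarrow> order_continuous_op T"
  and subspace_alg: "subspace \<AA>"
  and comp_mem: "S \<in> \<AA> \<Longrightarrow> T \<in> \<AA> \<Longrightarrow> S \<circ> T \<in> \<AA>"
  using subalgebra by (simp_all add: subalgebra_of_Ln_def)

lemma linear_mem: "T \<in> \<AA> \<Longrightarrow> linear T"
  using order_continuous_mem by (simp add: order_continuous_op_def)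

lemma bij_Phi: "bij_betw \<Phi> \<AA> \<AA>"
  and linear_Phi: "linear_on \<AA> \<Phi>"
  and Phi_comp: "S \<in> \<AA> \<Longrightarrow> T \<in> \<AA> \<Longrightarrow> \<Phi> (S \<circ> T) = \<Phi> S \<circ> \<Phi> T"
  and Phi_pos: "T \<in> \<AA> \<Longrightarrow> positive_op T \<Longrightarrow> positive_op (\<Phi> T)"
  using automorphism by (simp_all add: positive_algebra_automorphism_def)

lemma Phi_mem: "T \<in> \<AA> \<Longrightarrow> \<Phi> T \<in> \<AA>"
  using bij_Phi bij_betwE by blast

lemma Phi_eqD: "\<Phi> S = \<Phi> T \<Longrightarrow> S \<in> \<AA> \<Longrightarrow> T \<in> \<AA> \<Longrightarrow> S = T"
  using bij_Phi by (meson bij_betw_imp_inj_on inj_onD)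

lemma zero_mem: "0 \<in> \<AA>"
  using subspace_alg by (rule subspace_0)

lemma Phi_0: "\<Phi> 0 = 0"
  using linear_on_0[OF linear_Phi subspace_alg] .

lemma Phi_eq_0D: "T \<in> \<AA> \<Longrightarrow> \<Phi> T = 0 \<Longrightarrow> T = 0"
  using Phi_eqD[of T 0] zero_mem Phi_0 by simp

lemma Phi_diff: "S \<in> \<AA> \<Longrightarrow> T \<in> \<AA> \<Longrightarrow> \<Phi> (S - T) = \<Phi> S - \<Phi> T"
  using linear_onD(1)[OF linear_Phi, of "S - T" T] subspace_diff[OF subspace_alg] by simp

lemma Phi_scaleR: "T \<in> \<AA> \<Longrightarrow> \<Phi> (r *\<^sub>R T) = r *\<^sub>R \<Phi> T"
  using linear_onD(2)[OF linear_Phi] .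

lemma unit_op_finite_rank: "a \<in> A \<Longrightarrow> b \<in> A \<Longrightarrow> unit_op a b \<in> finite_rank_alg A"
  unfolding finite_rank_alg_def by (rule span_base) blast

lemma unit_op_mem: "a \<in> A \<Longrightarrow> b \<in> A \<Longrightarrow> unit_op a b \<in> \<AA>"
  using unit_op_finite_rank finite_rank by blast

lemma unit_op_apply: "a \<in> A \<Longrightarrow> b \<in> A \<Longrightarrow> unit_op a b b = a"
  by (simp add: rank_one_def coord_mem)

lemma unit_op_nonzero: "a \<in> A \<Longrightarrow> b \<in> A \<Longrightarrow> unit_op a b \<noteq> 0"
  using unit_op_apply[of a b] nonzero_mem[of a] by auto

lemma positive_unit_op: "a \<in> A \<Longrightarrow> b \<in> A \<Longrightarrow> positive_op (unit_op a b)"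
  by (simp add: positive_op_iff rank_one_def scaleR_nonneg_nonneg nonneg_mem coord_nonneg atom_mem)

lemma unit_op_comp: "b \<in> A \<Longrightarrow> c \<in> A \<Longrightarrow> unit_op a b \<circ> unit_op c d = (if b = c then unit_op a d else 0)"
  by (auto simp: rank_one_def fun_eq_iff coord_linear coord_mem)

text \<open>Compression by diagonal units isolates one matrix entry of \<open>T\<close>. Since
  \<open>\<Phi>\<close> respects products, this is how entries are carried over to
  \<open>\<Phi> T\<close>.\<close>

lemma unit_op_sandwich:
  assumes "linear T" "a \<in> A"
  shows "unit_op a a \<circ> T \<circ> unit_op b b = coord a (T b) *\<^sub>R unit_op a b"
  using assms(2) by (simp add: rank_one_def fun_eq_iff scaleR_fun_def linear_scale[OF assms(1)] coord_linear)

section \<open>Images of the diagonal units\<close>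

text \<open>Positivity of \<open>\<Phi>\<close> locates \<open>c\<close>. The inverse of
  \<open>\<Phi>\<close> is not known to be positive, so the preimage of \<open>unit_op c c\<close>
  is identified by orthogonality, order continuity and idempotence.\<close>

lemma Phi_unit_op_diag:
  assumes a: "a \<in> A"
  obtains c where "c \<in> A" "\<Phi> (unit_op a a) = unit_op c c"
proof -
  define Q where "Q b = \<Phi> (unit_op b b)" for b
  have Qm: "Q b \<in> \<AA>" if "b \<in> A" for b unfolding Q_def using that by (intro Phi_mem unit_op_mem)
  have Ql: "linear (Q b)" if "b \<in> A" for b using linear_mem[OF Qm[OF that]] .
  have Qp: "positive_op (Q b)" if "b \<in> A" for b
    unfolding Q_def using that by (intro Phi_pos unit_op_mem positive_unit_op)
  have QQ: "Q b (Q b' x) = (if b = b' then Q b x else 0)" if "b \<in> A" "b' \<in> A" for b b' x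
  proof -
    have "Q b \<circ> Q b' = \<Phi> (unit_op b b \<circ> unit_op b' b')"
      unfolding Q_def using that by (intro Phi_comp[symmetric] unit_op_mem)
    also have "\<dots> = (if b = b' then Q b else 0)"
      using that by (simp add: unit_op_comp Phi_0 Q_def)
    finally have "(Q b \<circ> Q b') x = (if b = b' then Q b else 0) x" by (rule arg_cong)
    then show ?thesis by simp
  qed
  \<comment> \<open>Injectivity of \<open>\<Phi>\<close> makes \<open>Q a\<close> nonzero, hence
    nonzero on the positive cone; the resulting \<open>y\<close> is fixed by \<open>Q a\<close> and
    killed by every other \<open>Q b\<close>.\<close>
  have "Q a \<noteq> 0" unfolding Q_def using Phi_eq_0D unit_op_mem unit_op_nonzero a by blast
  then obtain x where x: "0 \<le> x" "Q a x \<noteq> 0"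
    using linear_eq_0_on_cone[OF Ql[OF a]] by (metis zero_fun_apply ext)
  define y where "y = Q a x"
  have y: "0 \<le> y" "Q a y = y" "y \<noteq> 0" and Qby: "\<And>b. b \<in> A \<Longrightarrow> b \<noteq> a \<Longrightarrow> Q b y = 0"
    using x Qp[OF a] QQ a unfolding y_def positive_op_iff by auto
  \<comment> \<open>Otherwise \<open>Q a\<close> would kill every member of \<open>A\<close>
    occurring in \<open>y\<close>, and by order continuity also \<open>y = Q a y\<close>.\<close>
  obtain c where c: "c \<in> A" "coord c y \<noteq> 0" "Q a c \<noteq> 0"
    using order_continuous_eq_0_nonneg[OF order_continuous_mem[OF Qm[OF a]] y(1)] y(2,3) by metis
  \<comment> \<open>The component of \<open>z\<close> at \<open>c\<close> lies between
    \<open>0\<close> and \<open>z\<close>; applying the positive operator \<open>Q b\<close> gives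
    the squeeze behind both orthogonality facts that follow.\<close>
  have below: "coord c z *\<^sub>R Q b c \<le> Q b z" "0 \<le> coord c z *\<^sub>R Q b c" if "0 \<le> z" "b \<in> A" for z b
  proof -
    have "Q b (coord c z *\<^sub>R c) \<le> Q b z"
      using coord_nonneg(2)[OF atom_mem[OF c(1)] that(1)] by (rule positive_op_mono[OF Ql Qp, OF that(2,2)])
    then show "coord c z *\<^sub>R Q b c \<le> Q b z" by (simp add: linear_scale[OF Ql[OF that(2)]])
    show "0 \<le> coord c z *\<^sub>R Q b c"
      using Qp[OF that(2)] nonneg_mem[OF c(1)] coord_nonneg(1)[OF atom_mem[OF c(1)] that(1)]
      unfolding positive_op_iff by (simp add: scaleR_nonneg_nonneg)
  qed
  have Qc: "Q b c = 0" if "b \<in> A" "b \<noteq> a" for b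
  proof -
    have "coord c y *\<^sub>R Q b c = 0"
      using below[OF y(1) that(1)] Qby[OF that] by (simp add: antisym)
    then show ?thesis using c(2) by simp
  qed
  \<comment> \<open>Here the squeeze is applied with \<open>Q a\<close> to the vector
    \<open>Q b w\<close>, which \<open>Q a\<close> kills although it does not kill
    \<open>c\<close>.\<close>
  have cQ: "coord c (Q b z) = 0" if "b \<in> A" "b \<noteq> a" for b z
  proof -
    have "(coord c \<circ> Q b) z = 0"
    proof (rule linear_eq_0_on_cone[of "coord c \<circ> Q b"])
      show "linear (coord c \<circ> Q b)"
        using Ql[OF that(1)] linear_coord[OF atom_mem[OF c(1)]] by (rule linear_compose)
      fix w :: 'a assume "0 \<le> w"
      then have w: "0 \<le> Q b w" using Qp[OF that(1)] unfolding positive_op_iff by blast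
      have "coord c (Q b w) *\<^sub>R Q a c = 0"
        using below[OF w a] QQ[OF a that(1)] that(2) by (simp add: antisym)
      then show "(coord c \<circ> Q b) w = 0" using c(3) by simp
    qed
    then show ?thesis by simp
  qed
  \<comment> \<open>This preimage is orthogonal on both sides to all diagonal units except the one
    at \<open>a\<close>, so only its entry at \<open>(a, a)\<close> can survive.\<close>
  define S where "S = inv_into \<AA> \<Phi> (unit_op c c)"
  have S: "S \<in> \<AA>" "\<Phi> S = unit_op c c"
    unfolding S_def using bij_betw_inv_into_right[OF bij_Phi] bij_betwE[OF bij_betw_inv_into[OF bij_Phi]]
      unit_op_mem c(1) by auto
  have Sl: "linear S" using linear_mem[OF S(1)] .
  have bS: "unit_op b b \<circ> S = 0" "S \<circ> unit_op b b = 0" if b: "b \<in> A" "b \<noteq> a" for b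
  proof -
    have "\<Phi> (unit_op b b \<circ> S) = Q b \<circ> unit_op c c"
      unfolding Q_def S(2)[symmetric] using b S by (intro Phi_comp unit_op_mem)
    also have "\<dots> = 0" using Qc[OF b] by (simp add: fun_eq_iff rank_one_def linear_scale[OF Ql[OF b(1)]])
    finally show "unit_op b b \<circ> S = 0" by (rule Phi_eq_0D[rotated]) (intro comp_mem unit_op_mem b S(1))
    have "\<Phi> (S \<circ> unit_op b b) = unit_op c c \<circ> Q b"
      unfolding Q_def S(2)[symmetric] using b S by (intro Phi_comp unit_op_mem)
    also have "\<dots> = 0" using cQ[OF b] by (simp add: fun_eq_iff rank_one_def)
    finally show "S \<circ> unit_op b b = 0" by (rule Phi_eq_0D[rotated]) (intro comp_mem unit_op_mem b S(1))
  qed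
  define l where "l = coord a (S a)"
  have Sb: "S b = 0" if b: "b \<in> A" "b \<noteq> a" for b
    using fun_cong[OF bS(2)[OF b], of b] unit_op_apply[OF b(1) b(1)] by simp
  have Sa: "S a = l *\<^sub>R a"
  proof (rule eq_if_coord_eq)
    fix b assume b: "b \<in> A"
    show "coord b (S a) = coord b (l *\<^sub>R a)"
    proof (cases "b = a")
      case False
      then have "coord b (S a) *\<^sub>R b = 0"
        using fun_cong[OF bS(1)[OF b False], of a] by (simp add: rank_one_def)
      then show ?thesis using False nonzero_mem[OF b] b a by (simp add: coord_linear coord_mem)
    qed (use a in \<open>simp add: coord_linear coord_mem l_def\<close>)
  qed
  \<comment> \<open>An order continuous operator that vanishes on \<open>A\<close> is zero, so the
    values of \<open>S\<close> on \<open>A\<close> determine it.\<close>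
  have "(S - l *\<^sub>R unit_op a a) z = 0" for z
  proof (rule order_continuous_eq_0[of "S - l *\<^sub>R unit_op a a"])
    show "order_continuous_op (S - l *\<^sub>R unit_op a a)"
      by (intro order_continuous_mem subspace_diff[OF subspace_alg] subspace_scale[OF subspace_alg]
          unit_op_mem S a)
    show "(S - l *\<^sub>R unit_op a a) b = 0" if "b \<in> A" for b
      using that a Sa Sb[OF that] by (cases "b = a") (simp_all add: scaleR_fun_def rank_one_def coord_mem)
  qed
  then have S_eq: "S = l *\<^sub>R unit_op a a" by (simp add: fun_eq_iff)
  \<comment> \<open>Idempotence leaves \<open>l = 0\<close> or \<open>l = 1\<close>, and
    \<open>l = 0\<close> would make \<open>unit_op c c\<close> zero.\<close>
  have "\<Phi> (S \<circ> S) = \<Phi> S" unfolding Phi_comp[OF S(1,1)] S(2) using c(1) by (simp add: unit_op_comp)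
  then have "S \<circ> S = S" by (rule Phi_eqD) (intro comp_mem S(1))+
  then have "S (S a) = S a" by (metis comp_apply)
  then have "(l * l) *\<^sub>R a = l *\<^sub>R a" by (simp add: Sa linear_scale[OF Sl])
  then have "l * l = l" using nonzero_mem[OF a] by simp
  moreover have "l \<noteq> 0"
    using S(2) S_eq unit_op_nonzero[OF c(1) c(1)] Phi_0 by auto
  ultimately have "S = unit_op a a" using S_eq by simp
  then show thesis using that[OF c(1)] S(2) by simp
qed

section \<open>The permutation of the atoms\<close>

text \<open>This is the bijection \<open>\<pi>\<close>. The choice is unambiguous, since distinct
  members of \<open>A\<close> have distinct diagonal units.\<close>

definition perm :: "'a \<Rightarrow> 'a"
  where "perm a = (SOME c. c \<in> A \<and> \<Phi> (unit_op a a) = unit_op c c)"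

lemma perm:
  assumes "a \<in> A"
  shows perm_mem: "perm a \<in> A" and Phi_diag: "\<Phi> (unit_op a a) = unit_op (perm a) (perm a)"
proof -
  have "\<exists>c. c \<in> A \<and> \<Phi> (unit_op a a) = unit_op c c" using Phi_unit_op_diag[OF assms] by metis
  then have "perm a \<in> A \<and> \<Phi> (unit_op a a) = unit_op (perm a) (perm a)"
    unfolding perm_def by (rule someI_ex)
  then show "perm a \<in> A" "\<Phi> (unit_op a a) = unit_op (perm a) (perm a)" by simp_all
qed

text \<open>Injectivity is inherited from \<open>\<Phi>\<close>. If \<open>c\<close> were missed,
  the preimage of \<open>unit_op c c\<close> would annihilate every diagonal unit from the left,
  hence vanish on \<open>A\<close>, hence be zero by order continuity.\<close>

lemma bij_perm: "bij_betw perm A A"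
proof (intro bij_betwI' perm_mem)
  fix a b assume ab: "a \<in> A" "b \<in> A"
  show "(perm a = perm b) \<longleftrightarrow> a = b"
  proof
    assume "perm a = perm b"
    then have "\<Phi> (unit_op a a) = \<Phi> (unit_op b b)" using ab by (simp add: Phi_diag)
    then have "unit_op a a = unit_op b b" by (rule Phi_eqD) (intro unit_op_mem ab)+
    then have "unit_op b b a = a" using unit_op_apply[OF ab(1,1)] by simp
    then show "a = b" using nonzero_mem[OF ab(1)] ab by (cases "a = b") (simp_all add: rank_one_def coord_mem)
  qed simp
next
  fix c assume c: "c \<in> A"
  define S where "S = inv_into \<AA> \<Phi> (unit_op c c)"
  have S: "S \<in> \<AA>" "\<Phi> S = unit_op c c"
    unfolding S_def using bij_betw_inv_into_right[OF bij_Phi] bij_betwE[OF bij_betw_inv_into[OF bij_Phi]]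
      unit_op_mem c by auto
  show "\<exists>a\<in>A. c = perm a"
  proof (rule ccontr)
    assume no: "\<not> (\<exists>a\<in>A. c = perm a)"
    have "S a = 0" if a: "a \<in> A" for a
    proof -
      have "\<Phi> (S \<circ> unit_op a a) = unit_op c c \<circ> unit_op (perm a) (perm a)"
        unfolding Phi_diag[OF a, symmetric] S(2)[symmetric] by (intro Phi_comp unit_op_mem a S)
      also have "\<dots> = 0" using no a by (auto simp: unit_op_comp c perm_mem)
      finally have "S \<circ> unit_op a a = 0" by (rule Phi_eq_0D[rotated]) (intro comp_mem unit_op_mem a S(1))
      from fun_cong[OF this, of a] show ?thesis using unit_op_apply[OF a a] by simp
    qed
    then have "S = 0" using order_continuous_eq_0[OF order_continuous_mem[OF S(1)]] by (simp add: fun_eq_iff)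
    then show False using S(2) Phi_0 unit_op_nonzero[OF c c] by simp
  qed
qed

section \<open>Matrix entries of the images and their weights\<close>

text \<open>The scalar \<open>\<mu>(a, b)\<close> by which \<open>\<Phi>\<close> rescales the matrix
  unit at \<open>(a, b)\<close>, read off as a matrix entry.\<close>

definition weight :: "'a \<Rightarrow> 'a \<Rightarrow> real"
  where "weight a b = coord (perm a) (\<Phi> (unit_op a b) (perm b))"

text \<open>Applying \<open>\<Phi>\<close> to the compression identity for \<open>T\<close> turns it
  into the compression of \<open>\<Phi> T\<close> by the images of the diagonal units. The rescaling
  factor does not depend on \<open>T\<close>, and \<open>T\<close> ranges over the whole algebra, as
  the supremum formula requires.\<close>

lemma coord_Phi:
  assumes T: "T \<in> \<AA>" and a: "a \<in> A" and b: "b \<in> A"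
  shows "coord (perm a) (\<Phi> T (perm b)) = weight a b * coord a (T b)"
proof -
  have "\<Phi> (unit_op a a \<circ> T \<circ> unit_op b b) = \<Phi> (unit_op a a) \<circ> \<Phi> T \<circ> \<Phi> (unit_op b b)"
    by (simp add: Phi_comp comp_mem unit_op_mem a b T)
  then have "\<Phi> (coord a (T b) *\<^sub>R unit_op a b) = coord (perm a) (\<Phi> T (perm b)) *\<^sub>R unit_op (perm a) (perm b)"
    by (simp only: Phi_diag a b unit_op_sandwich perm_mem linear_mem Phi_mem T)
  then have "coord a (T b) *\<^sub>R \<Phi> (unit_op a b) = coord (perm a) (\<Phi> T (perm b)) *\<^sub>R unit_op (perm a) (perm b)"
    by (simp add: Phi_scaleR unit_op_mem a b)
  from fun_cong[OF this, of "perm b"]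
  have "coord a (T b) *\<^sub>R \<Phi> (unit_op a b) (perm b) = coord (perm a) (\<Phi> T (perm b)) *\<^sub>R perm a"
    by (simp add: scaleR_fun_def unit_op_apply perm_mem a b)
  then have "coord (perm a) (coord a (T b) *\<^sub>R \<Phi> (unit_op a b) (perm b))
      = coord (perm a) (coord (perm a) (\<Phi> T (perm b)) *\<^sub>R perm a)" by simp
  then show ?thesis by (simp add: coord_linear perm_mem a coord_mem weight_def mult.commute)
qed

lemma Phi_unit_op:
  assumes a: "a \<in> A" and b: "b \<in> A"
  shows "\<Phi> (unit_op a b) = weight a b *\<^sub>R unit_op (perm a) (perm b)"
proof -
  have "\<Phi> (unit_op a b) = \<Phi> (unit_op a a \<circ> unit_op a b \<circ> unit_op b b)"
    by (simp add: unit_op_comp a b)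
  also have "\<dots> = unit_op (perm a) (perm a) \<circ> \<Phi> (unit_op a b) \<circ> unit_op (perm b) (perm b)"
    by (simp only: Phi_comp comp_mem unit_op_mem a b Phi_diag)
  also have "\<dots> = weight a b *\<^sub>R unit_op (perm a) (perm b)"
    unfolding weight_def by (intro unit_op_sandwich linear_mem Phi_mem unit_op_mem a b perm_mem)
  finally show ?thesis .
qed

text \<open>Nonnegativity comes from positivity of \<open>\<Phi>\<close>, and nonvanishing from its
  injectivity.\<close>

lemma weight_pos:
  assumes a: "a \<in> A" and b: "b \<in> A"
  shows "0 < weight a b"
proof -
  have "positive_op (\<Phi> (unit_op a b))" by (intro Phi_pos unit_op_mem positive_unit_op a b)
  then have "0 \<le> \<Phi> (unit_op a b) (perm b)"
    using nonneg_mem[OF perm_mem[OF b]] unfolding positive_op_iff by blast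
  then have "0 \<le> weight a b"
    unfolding weight_def by (rule coord_nonneg(1)[OF atom_mem[OF perm_mem[OF a]]])
  moreover have "weight a b \<noteq> 0"
    using Phi_unit_op[OF a b] Phi_eq_0D[OF unit_op_mem[OF a b]] unit_op_nonzero[OF a b] by auto
  ultimately show ?thesis by simp
qed

text \<open>The cocycle identity, obtained by applying \<open>\<Phi>\<close> to the product rule for
  matrix units.\<close>

lemma weight_mult:
  assumes "a \<in> A" "b \<in> A" "c \<in> A"
  shows "weight a b * weight b c = weight a c"
proof -
  have "\<Phi> (unit_op a c) = \<Phi> (unit_op a b) \<circ> \<Phi> (unit_op b c)"
    using Phi_comp[OF unit_op_mem unit_op_mem, of a b b c] assms by (simp add: unit_op_comp)
  then have "\<Phi> (unit_op a c) (perm c) = \<Phi> (unit_op a b) (\<Phi> (unit_op b c) (perm c))" by simp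
  then have "weight a c *\<^sub>R perm a = weight a b *\<^sub>R unit_op (perm a) (perm b) (weight b c *\<^sub>R perm b)"
    using assms by (simp add: Phi_unit_op scaleR_fun_def unit_op_apply perm_mem)
  also have "\<dots> = (weight a b * weight b c) *\<^sub>R perm a"
    using assms by (simp add: rank_one_def coord_linear coord_mem perm_mem)
  finally show ?thesis using nonzero_mem[OF perm_mem[OF assms(1)]] by simp
qed

text \<open>The scalars \<open>\<delta>\<close>: fixing a reference atom as second index writes the
  cocycle as a ratio. If \<open>A\<close> is empty the choice is arbitrary, but then there is no
  \<open>a \<in> A\<close> to scale.\<close>

definition scale :: "'a \<Rightarrow> real"
  where "scale a = weight a (SOME b. b \<in> A)"

lemma scale_pos: "a \<in> A \<Longrightarrow> 0 < scale a"
  unfolding scale_def by (rule weight_pos) (auto intro: someI)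

lemma weight_eq_scale_ratio:
  assumes "a \<in> A" "b \<in> A"
  shows "weight a b = scale a / scale b"
proof -
  have "weight a b * scale b = scale a"
    unfolding scale_def using assms by (intro weight_mult) (auto intro: someI)
  then show ?thesis using scale_pos[OF assms(2)] by (simp add: field_simps)
qed

lemma linear_extension: "\<exists>P. linear P \<and> (\<forall>a\<in>A. P a = f a)" for f :: "'a \<Rightarrow> 'a"
  using linear_independent_extend[OF independent_atoms] by blast

text \<open>Each matrix unit maps into the line through a member of \<open>A\<close>, and this
  passes to linear combinations. Values of \<open>T\<close> may thus be fed to \<open>D\<close> and
  \<open>P\<close>, which are controlled only on \<open>span A\<close>.\<close>

lemma finite_rank_range:
  assumes "T \<in> finite_rank_alg A"
  shows "T x \<in> span A"
proof -
  have "finite_rank_alg A \<subseteq> {T. \<forall>x. T x \<in> span A}"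
    unfolding finite_rank_alg_def
  proof (rule span_minimal)
    show "{unit_op a b |a b. a \<in> A \<and> b \<in> A} \<subseteq> {T. \<forall>x. T x \<in> span A}"
      by (auto simp: rank_one_def intro: span_scale span_base)
    show "subspace {T. \<forall>x. T x \<in> span A}"
      by (auto simp: subspace_def scaleR_fun_def intro: span_add span_scale span_zero)
  qed
  then show ?thesis using assms by blast
qed

lemma perm_cases:
  assumes "c \<in> A" obtains a where "a \<in> A" "c = perm a"
  using bij_perm assms unfolding bij_betw_def by blast

end

theorem theorem5p8:
  fixes A :: "'a::archimedean_vector_lattice set"
    and \<AA> :: "('a \<Rightarrow> 'a) set"
    and \<Phi> :: "('a \<Rightarrow> 'a) \<Rightarrow> ('a \<Rightarrow> 'a)"
  assumes "atomic_lattice TYPE('a)"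
    and "maximal_disjoint_atoms A"
    and "subalgebra_of_Ln \<AA>"
    and "finite_rank_alg A \<subseteq> \<AA>"
    and "positive_algebra_automorphism \<AA> \<Phi>"
  shows "\<exists>\<pi> \<delta> P D. bij_betw \<pi> A A \<and> (\<forall>a\<in>A. 0 < (\<delta> a :: real)) \<and>
    invertible_linear_on (span A) P \<and> (\<forall>a\<in>A. P a = \<pi> a) \<and>
    invertible_linear_on (span A) D \<and> (\<forall>a\<in>A. D a = \<delta> a *\<^sub>R a) \<and>
    (\<forall>T\<in>finite_rank_alg A. \<Phi> T ` span A \<subseteq> span A \<and>
      (\<forall>x\<in>span A. \<Phi> T x = conj_on (span A) P D T x)) \<and>
    (\<forall>T\<in>\<AA>. positive_op T \<longrightarrow>
      is_op_sup_on (span A) (conj_on (span A) P D ` (op_interval0 T \<inter> finite_rank_alg A)) (\<Phi> T))"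
proof -
  interpret automorphism_setup A \<AA> \<Phi> using assms by unfold_locales

  \<comment> \<open>Construction of the operators and of their inverses\<close>
  obtain P where P0: "linear P" "\<forall>a\<in>A. P a = perm a"
    using linear_extension[of "perm"] by blast
  note P = P0(1) bspec[OF P0(2)]
  obtain P' where P'0: "linear P'" "\<forall>a\<in>A. P' a = inv_into A perm a"
    using linear_extension[of "inv_into A perm"] by blast
  note P' = P'0(1) bspec[OF P'0(2)]
  obtain D where D0: "linear D" "\<forall>a\<in>A. D a = scale a *\<^sub>R a"
    using linear_extension[of "\<lambda>a. scale a *\<^sub>R a"] by blast
  note D = D0(1) bspec[OF D0(2)]
  obtain D' where D'0: "linear D'" "\<forall>a\<in>A. D' a = inverse (scale a) *\<^sub>R a"
    using linear_extension[of "\<lambda>a. inverse (scale a) *\<^sub>R a"] by blast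
  note D' = D'0(1) bspec[OF D'0(2)]
  have P'_perm: "P' (perm a) = a" if "a \<in> A" for a
    using that P'(2)[OF perm_mem[OF that]] bij_betw_inv_into_left[OF bij_perm] by simp
  have inv_perm: "inv_into A perm a \<in> A" "perm (inv_into A perm a) = a" if "a \<in> A" for a
    using that bij_betw_inv_into_right[OF bij_perm] bij_betwE[OF bij_betw_inv_into[OF bij_perm]] by auto
  have P_in: "P a \<in> span A" if "a \<in> A" for a
    using that by (simp add: P perm_mem span_base)
  have P'_in: "P' a \<in> span A" if "a \<in> A" for a
    using that by (simp add: P' inv_perm span_base)
  have PP': "P (P' a) = a" if "a \<in> A" for a
    using that by (simp add: P P' inv_perm)
  have P'P: "P' (P a) = a" if "a \<in> A" for a
    using that by (simp add: P P'_perm)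
  note inv_P = bij_betw_span_of_inverse[OF P(1) P_in P'(1) P'_in P'P PP']
  have D_in: "D a \<in> span A" and D'_in: "D' a \<in> span A" if "a \<in> A" for a
    using that by (simp_all add: D D' span_base span_scale)
  have DD': "D (D' a) = a" and D'D: "D' (D a) = a" if "a \<in> A" for a
    using that scale_pos[OF that] by (simp_all add: D D' linear_scale[OF D(1)] linear_scale[OF D'(1)])
  note inv_D = bij_betw_span_of_inverse[OF D(1) D_in D'(1) D'_in D'D DD']
  \<comment> \<open>A globally linear substitute for \<open>conj_on\<close>, with the linear maps
    \<open>D'\<close> and \<open>P'\<close> in place of the inverses on
    \<open>span A\<close>.\<close>
  define G where "G T = P \<circ> D \<circ> T \<circ> D' \<circ> P'" for T
  have conj_eq: "conj_on (span A) P D T x = G T x" if "x \<in> span A" for T x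
    using that by (simp add: conj_on_def G_def inv_P inv_D)
  have G_linear: "linear (G T)" if "linear T" for T
    unfolding G_def using that P(1) P'(1) D(1) D'(1) by (intro linear_compose)
  have coord_PD: "coord (perm a) (P (D y)) = scale a * coord a y" if a: "a \<in> A" and y: "y \<in> span A" for a y
  proof -
    have "(coord (perm a) \<circ> P \<circ> D) y = (\<lambda>y. scale a * coord a y) y"
    proof (rule linear_eq_on_span[OF _ _ _ y])
      show "linear (coord (perm a) \<circ> P \<circ> D)"
        using P(1) D(1) linear_coord[OF atom_mem[OF perm_mem[OF a]]] by (intro linear_compose)
      show "linear (\<lambda>y. scale a * coord a y)"
        by (rule linearI) (simp_all add: coord_linear a algebra_simps)
      fix b assume b: "b \<in> A"
      have "perm a = perm b \<longleftrightarrow> a = b"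
        using bij_perm a b by (auto simp: bij_betw_def dest: inj_onD)
      then show "(coord (perm a) \<circ> P \<circ> D) b = scale a * coord a b"
        using a b by (simp add: D P linear_scale[OF P(1)] coord_linear coord_mem perm_mem)
    qed
    then show ?thesis by simp
  qed

  \<comment> \<open>The conjugation formula for finite rank operators\<close>
  have Phi_G: "\<Phi> T x = G T x" if T: "T \<in> finite_rank_alg A" and x: "x \<in> span A" for T x
  proof (rule linear_eq_on_span[OF _ _ _ x])
    have T': "T \<in> \<AA>" using T finite_rank by blast
    show "linear (\<Phi> T)" "linear (G T)" using T' by (simp_all add: linear_mem Phi_mem G_linear)
    fix c assume "c \<in> A"
    then obtain b where b: "b \<in> A" "c = perm b" by (rule perm_cases)
    show "\<Phi> T c = G T c"
    proof (rule eq_if_coord_eq)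
      fix d assume "d \<in> A"
      then obtain a where a: "a \<in> A" "d = perm a" by (rule perm_cases)
      have "G T c = P (D (T (inverse (scale b) *\<^sub>R b)))"
        unfolding G_def using b by (simp add: P'_perm D')
      then have "coord d (G T c) = scale a * coord a (T (inverse (scale b) *\<^sub>R b))"
        using coord_PD[OF a(1) finite_rank_range[OF T]] a(2) by simp
      \<comment> \<open>The factor \<open>scale a\<close> comes from \<open>D\<close> and the
        inverse of \<open>scale b\<close> from \<open>D'\<close>; their product is the
        weight.\<close>
      also have "\<dots> = weight a b * coord a (T b)"
        by (simp add: linear_scale[OF linear_mem[OF T']] coord_linear a b weight_eq_scale_ratio divide_inverse)
      also have "\<dots> = coord d (\<Phi> T c)" unfolding a(2) b(2) by (rule coord_Phi[OF T' a(1) b(1), symmetric])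
      finally show "coord d (\<Phi> T c) = coord d (G T c)" by simp
    qed
  qed
  have invariant: "\<Phi> T x \<in> span A" if T: "T \<in> finite_rank_alg A" and x: "x \<in> span A" for T x
  proof -
    have "D (T (D' (P' x))) \<in> span A" using bij_betwE[OF inv_D(1)] finite_rank_range[OF T] by blast
    then have "G T x \<in> span A" unfolding G_def using bij_betwE[OF inv_P(1)] by simp
    then show ?thesis using Phi_G[OF T x] by simp
  qed

  \<comment> \<open>The supremum formula for positive operators\<close>
  have "is_op_sup_on (span A) (conj_on (span A) P D ` (op_interval0 T \<inter> finite_rank_alg A)) (\<Phi> T)"
    if T: "T \<in> \<AA>" and pos: "positive_op T" for T
    unfolding is_op_sup_on_def
  proof (intro conjI ballI allI impI)
    have Tl: "linear T" using linear_mem[OF T] .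
    show "linear_on (span A) (\<Phi> T)" by (intro linear_imp_linear_on linear_mem Phi_mem T)
    show "op_le (span A) S (\<Phi> T)"
      if S_in: "S \<in> conj_on (span A) P D ` (op_interval0 T \<inter> finite_rank_alg A)" for S
    proof -
      obtain S' where S': "S = conj_on (span A) P D S'" "S' \<in> op_interval0 T" "S' \<in> finite_rank_alg A"
        using S_in by blast
      have S'm: "S' \<in> \<AA>" using S'(3) finite_rank by blast
      \<comment> \<open>The upper bound property is positivity of \<open>\<Phi>\<close> applied to
        the difference.\<close>
      have "positive_op (T - S')" using S'(2) by (simp add: op_interval0_def op_le_def)
      then have "positive_op (\<Phi> (T - S'))" by (intro Phi_pos subspace_diff[OF subspace_alg] T S'm)
      then have "\<Phi> S' x \<le> \<Phi> T x" if "0 \<le> x" for x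
        using that by (simp add: Phi_diff T S'm op_le_def)
      then show ?thesis unfolding op_le_def S'(1) by (simp add: conj_eq flip: Phi_G[OF S'(3)])
    qed
    fix R assume R: "linear_on (span A) R"
      and ub: "\<forall>S\<in>conj_on (span A) P D ` (op_interval0 T \<inter> finite_rank_alg A). op_le (span A) S R"
    \<comment> \<open>Leastness is checked at the members of \<open>A\<close>, one coordinate at a
      time, with a test operator that depends on the atom and the coordinate.\<close>
    have gen: "\<Phi> T c \<le> R c" if c: "c \<in> A" for c
    proof (rule le_if_coord_le)
      obtain b where b: "b \<in> A" "c = perm b" using c by (rule perm_cases)
      fix d assume d: "d \<in> A"
      then obtain a where a: "a \<in> A" "d = perm a" by (rule perm_cases)
      \<comment> \<open>\<open>S\<close> keeps only the entry of \<open>T\<close> at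
        \<open>(a, b)\<close>; this alone determines the coordinate at \<open>d\<close> of
        \<open>\<Phi> T c\<close>.\<close>
      define S where "S = coord a (T b) *\<^sub>R unit_op a b"
      have S: "S \<in> finite_rank_alg A"
        unfolding S_def finite_rank_alg_def
        by (rule span_scale) (use unit_op_finite_rank[OF a(1) b(1)] in \<open>simp add: finite_rank_alg_def\<close>)
      have Sm: "S \<in> \<AA>" using S finite_rank by blast
      have "0 \<le> S x" "S x \<le> T x" if x: "0 \<le> x" for x
      proof -
        have y: "0 \<le> coord b x *\<^sub>R b" "coord b x *\<^sub>R b \<le> x"
          using coord_nonneg[OF atom_mem[OF b(1)] x] nonneg_mem[OF b(1)] by (simp_all add: scaleR_nonneg_nonneg)
        \<comment> \<open>So \<open>S x\<close> is the component at \<open>a\<close> of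
          \<open>T\<close> applied to the component of \<open>x\<close> at \<open>b\<close>; passing
          to a component decreases a positive vector, which gives
          \<open>S x \<le> T x\<close>.\<close>
        have Sx: "S x = coord a (T (coord b x *\<^sub>R b)) *\<^sub>R a"
          by (simp add: S_def scaleR_fun_def rank_one_def linear_scale[OF Tl] coord_linear a mult.commute)
        have Ty: "0 \<le> T (coord b x *\<^sub>R b)" using pos y(1) unfolding positive_op_iff by blast
        show "0 \<le> S x" unfolding Sx
          using coord_nonneg(1)[OF atom_mem[OF a(1)] Ty] nonneg_mem[OF a(1)] by (rule scaleR_nonneg_nonneg)
        have "S x \<le> T (coord b x *\<^sub>R b)" unfolding Sx by (rule coord_nonneg(2)[OF atom_mem[OF a(1)] Ty])
        also have "\<dots> \<le> T x" using Tl pos y(2) by (rule positive_op_mono)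
        finally show "S x \<le> T x" .
      qed
      then have "S \<in> op_interval0 T" using linear_mem[OF Sm] by (simp add: op_interval0_def op_le_def)
      then have "op_le (span A) (conj_on (span A) P D S) R" using ub S by blast
      then have "conj_on (span A) P D S c \<le> R c"
        using nonneg_mem[OF c] span_base[OF c] unfolding op_le_def by blast
      then have "\<Phi> S c \<le> R c" using Phi_G[OF S] conj_eq span_base[OF c] by simp
      then have "coord d (\<Phi> S c) \<le> coord d (R c)" by (rule coord_mono[OF d])
      moreover have "coord d (\<Phi> S c) = coord d (\<Phi> T c)"
        unfolding a(2) b(2) coord_Phi[OF Sm a(1) b(1)] coord_Phi[OF T a(1) b(1)]
        by (simp add: S_def scaleR_fun_def unit_op_apply coord_linear coord_mem a b)
      ultimately show "coord d (\<Phi> T c) \<le> coord d (R c)" by simp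
    qed
    show "op_le (span A) (\<Phi> T) R" unfolding op_le_def
    proof (intro ballI impI)
      fix x assume x: "x \<in> span A" "0 \<le> x"
      \<comment> \<open>A positive vector of \<open>span A\<close> is a combination of members of
        \<open>A\<close> with nonnegative coefficients, so the comparison at atoms extends by
        linearity.\<close>
      obtain F where F: "finite F" "F \<subseteq> A" "x = (\<Sum>c\<in>F. coord c x *\<^sub>R c)"
        using x(1) by (rule span_mem_expansion)
      have FA: "F \<subseteq> span A" using F(2) span_superset by blast
      have expand: "L x = (\<Sum>c\<in>F. coord c x *\<^sub>R L c)" if "linear_on (span A) L" for L
        using linear_on_sum_scaleR[OF that subspace_span F(1) FA, of "\<lambda>c. coord c x"] F(3) by simp
      have "(\<Sum>c\<in>F. coord c x *\<^sub>R \<Phi> T c) \<le> (\<Sum>c\<in>F. coord c x *\<^sub>R R c)"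
      proof (rule sum_mono)
        fix c assume "c \<in> F"
        then have "c \<in> A" using F(2) by blast
        then show "coord c x *\<^sub>R \<Phi> T c \<le> coord c x *\<^sub>R R c"
          using gen coord_nonneg(1)[OF atom_mem x(2)] by (intro scaleR_left_mono)
      qed
      then show "\<Phi> T x \<le> R x"
        using expand[OF R] expand[OF linear_imp_linear_on[OF linear_mem[OF Phi_mem[OF T]]]] by simp
    qed
  qed
  moreover have "invertible_linear_on (span A) P" "invertible_linear_on (span A) D"
    unfolding invertible_linear_on_def using inv_P(1) inv_D(1) P(1) D(1) linear_imp_linear_on by blast+
  ultimately show ?thesis
    using bij_perm scale_pos P(2) D(2) Phi_G conj_eq invariant
    by (intro exI[of _ perm] exI[of _ scale] exI[of _ P] exI[of _ D]) auto
qed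

end
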